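(* For every infinite, connected, locally finite graph $G=(V,E)$, $$p_c^*(G)<1 \iff \kappa(G)<\infty .$$
   Context: Let $G=(V,E)$ be an infinite, connected, locally finite graph (edges are unordered pairs $\{u,v\}$ of vertices). Cutsets. A set of edges $F\subset E$ is called a cutset from a vertex $v$ to $\infty$ if $v$ belongs to a finite connected component of $(V,E\setminus F)$. A cutset from $v$ to $\infty$ is called minimal if no proper subset of it is a cutset from $v$ to $\infty$. For $n\ge 1$, let $\mathcal{Q}_n(v)$ be the set of minimal cutsets from $v$ to $\infty$ of cardinality $n$, and define $$q_n:=\sup_{v\in V}|\mathcal{Q}_n(v)|\in[0,\infty],\qquad \kappa(G):=\sup_{n\ge 1} q_n^{1/n}\in[0,\infty],$$ where $|\emptyset|:=0$, and $q_n=\infty$ is allowed (in which case $\kappa(G)=\infty$). Percolation. For $p\in[0,1]$, let $\mathrm{P}_p$ denote Bernoulli bond percolation of parameter $p$ on $G$, i.e. the product probability measure on $\{0,1\}^E$ under which each edge is open (value $1$) with probability $p$ independently of the other edges. Let $\theta_v(p):=\mathrm{P}_p(v\leftrightarrow\infty)$, where $v\leftrightarrow\infty$ is the event that $v$ belongs to an infinite open connected component (an infinite connected component of the graph $(V,\{\text{open edges}\})$). Define $$\theta^*(p):=\inf_{v\in V}\theta_v(p),\qquad p_c^*(G):=\inf\{p\in[0,1]:\theta^*(p)>0\}.$$ *)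

theory Defs
  imports "HOL-Probability.Probability"
begin

definition adj :: "'a set set \<Rightarrow> ('a \<times> 'a) set" where
  "adj F = {(x, y). {x, y} \<in> F}"

text \<open>The connected component of \<open>v\<close> in the graph \<open>(V, F)\<close>; the vertex set need not be
  mentioned, since \<open>v \<in> V\<close> and the edges in \<open>F\<close> join vertices of \<open>V\<close>.\<close>

definition component :: "'a set set \<Rightarrow> 'a \<Rightarrow> 'a set" where
  "component F v = {w. (v, w) \<in> (adj F)\<^sup>*}"

locale infinite_connected_locally_finite_graph =
  fixes V :: "'a set" and E :: "'a set set"
  assumes edges: "\<And>e. e \<in> E \<Longrightarrow> \<exists>u\<in>V. \<exists>v\<in>V. u \<noteq> v \<and> e = {u, v}"
    and infinite_vertices: "infinite V"
    and connected: "\<And>u v. u \<in> V \<Longrightarrow> v \<in> V \<Longrightarrow> v \<in> component E u"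
    and locally_finite: "\<And>v. v \<in> V \<Longrightarrow> finite {e \<in> E. v \<in> e}"

definition cutset :: "'a set set \<Rightarrow> 'a \<Rightarrow> 'a set set \<Rightarrow> bool" where
  "cutset E v F \<longleftrightarrow> F \<subseteq> E \<and> finite (component (E - F) v)"

definition minimal_cutset :: "'a set set \<Rightarrow> 'a \<Rightarrow> 'a set set \<Rightarrow> bool" where
  "minimal_cutset E v F \<longleftrightarrow> cutset E v F \<and> (\<forall>F'. F' \<subset> F \<longrightarrow> \<not> cutset E v F')"

text \<open>The finiteness condition matters only for \<open>n = 0\<close>, as \<open>card\<close> is \<open>0\<close> on infinite sets.\<close>

definition minimal_cutsets :: "'a set set \<Rightarrow> nat \<Rightarrow> 'a \<Rightarrow> 'a set set set" where
  "minimal_cutsets E n v = {F. minimal_cutset E v F \<and> finite F \<and> card F = n}"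

text \<open>The cardinality of a set of cutsets may be infinite, so it is taken with respect to
  the counting measure instead of \<open>card\<close>.\<close>

definition q_sup :: "'a set \<Rightarrow> 'a set set \<Rightarrow> nat \<Rightarrow> ennreal" where
  "q_sup V E n = (SUP v\<in>V. emeasure (count_space UNIV) (minimal_cutsets E n v))"

definition ennreal_root :: "nat \<Rightarrow> ennreal \<Rightarrow> ennreal" where
  "ennreal_root n x = (if x = \<infinity> then \<infinity> else ennreal (root n (enn2real x)))"

definition kappa :: "'a set \<Rightarrow> 'a set set \<Rightarrow> ennreal" where
  "kappa V E = (SUP n\<in>{1..}. ennreal_root n (q_sup V E n))"

text \<open>A configuration maps each edge to \<open>True\<close> (open, with probability \<open>p\<close>) or \<open>False\<close>.\<close>

definition percolation :: "'a set set \<Rightarrow> real \<Rightarrow> ('a set \<Rightarrow> bool) measure" where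
  "percolation E p = PiM E (\<lambda>_. measure_pmf (bernoulli_pmf p))"

definition open_edges :: "'a set set \<Rightarrow> ('a set \<Rightarrow> bool) \<Rightarrow> 'a set set" where
  "open_edges E \<omega> = {e \<in> E. \<omega> e}"

text \<open>A connected, locally finite graph is countable, so the event below is measurable.\<close>

definition theta :: "'a set set \<Rightarrow> 'a \<Rightarrow> real \<Rightarrow> real" where
  "theta E v p = measure (percolation E p)
     {\<omega> \<in> space (percolation E p). infinite (component (open_edges E \<omega>) v)}"

definition theta_star :: "'a set \<Rightarrow> 'a set set \<Rightarrow> real \<Rightarrow> real" where
  "theta_star V E p = (INF v\<in>V. theta E v p)"

text \<open>The set below contains \<open>1\<close> and is bounded below, so \<open>Inf\<close> on the reals is the true infimum.\<close>

definition pc_star :: "'a set \<Rightarrow> 'a set set \<Rightarrow> real" where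
  "pc_star V E = Inf {p \<in> {0..1}. theta_star V E p > 0}"

end

theory Submission
  imports Defs
begin

text \<open>If \<open>\<kappa>\<close> is finite, Peierls' argument applies: a finite cluster of \<open>v\<close> is enclosed by a minimal
  cutset all of whose edges are closed, and for \<open>p\<close> close to \<open>1\<close> the expected number of such
  cutsets is at most \<open>1/3\<close>, uniformly in \<open>v\<close> (\<open>peierls_bound\<close>).

  For the converse let \<open>\<theta> > 0\<close> be a lower bound for all \<open>\<theta>\<^sub>u(p)\<close> with \<open>p < 1\<close>.  Let \<open>F\<close> be a minimal
  cutset of \<open>v\<close> with \<open>n\<close> edges, \<open>A\<close> the finite component that it cuts off, and \<open>Y\<close> the set of
  endpoints of \<open>F\<close> outside \<open>A\<close>.  Consider the event that all edges of \<open>F\<close> are closed while every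
  vertex of \<open>Y\<close> is connected to infinity by open edges avoiding \<open>A\<close>.  On this event \<open>A\<close> is the component of
  \<open>v\<close> in the set of vertices not connected to infinity, so the events of different cutsets are disjoint
  (\<open>cut_events_disjoint\<close>).  If, at some density below \<open>1\<close>, each of them has probability at least \<open>\<gamma>\<^sup>n\<close>,
  with \<open>\<gamma> > 0\<close> depending only on \<open>p\<close> and \<open>\<theta>\<close>, then there are at most \<open>\<gamma>\<^sup>-\<^sup>n\<close> cutsets.  Infinity may here be replaced by the
  complement \<open>T\<close> of a large finite set \<open>B\<close>, so that only finitely many edges matter.

  The lower bound is the heart of the matter (\<open>connection_probability\<close>).  A vertex of \<open>Y\<close> is connected to
  infinity with probability at least \<open>\<theta>\<close>, but possibly only through \<open>A\<close>; all that can be said off \<open>A\<close> is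
  that every vertex is connected to \<open>Y \<union> T\<close> with probability at least \<open>\<theta>\<close>.  Now split \<open>Y \<union> T\<close>
  between two sets \<open>Z\<close> and \<open>W\<close>, with \<open>T \<subseteq> W\<close>, and walk from \<open>Z\<close> to \<open>T\<close>: somewhere on the way
  the set likely to be reached switches from \<open>Z\<close> to \<open>W\<close>, and there, by Harris' inequality, \<open>Z\<close> is joined
  to \<open>W\<close> with probability at least a constant \<open>c\<close> (\<open>join_probability\<close>).  Hence if the clusters of \<open>Y \<union> T\<close> have been explored and \<open>k\<close> of them are
  stranded, i.e. miss \<open>T\<close>, a fresh configuration joins each of these to another one or to \<open>T\<close> with
  probability at least \<open>c\<^sup>k\<close>.  Of the closed edges found by the exploration only two per stranded
  cluster have to be opened in order to use these connections; opening every edge with an extra probability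
  \<open>\<epsilon>\<close> opens them with probability at least \<open>\<epsilon>\<^sup>2\<^sup>k\<close>.  So one round at least halves the number of stranded clusters at the price
  \<open>(\<epsilon>\<^sup>2 c)\<^sup>k\<close> (\<open>merging_round\<close>).  With \<open>k = n / 2\<^sup>i\<close> and \<open>\<epsilon> = 2\<^sup>-\<^sup>i\<^sup>-\<^sup>2\<close> in round \<open>i\<close> the total price is
  exponential in \<open>n\<close>, and the densities stay below \<open>(1 + p) / 2\<close>.\<close>

section \<open>Bernoulli percolation on a finite set of edges\<close>

definition cube_expectation :: "'e set \<Rightarrow> real \<Rightarrow> ('e set \<Rightarrow> real) \<Rightarrow> real" where
  "cube_expectation X p f = (\<Sum>S\<in>Pow X. p ^ card S * (1 - p) ^ card (X - S) * f S)"

definition cube_prob :: "'e set \<Rightarrow> real \<Rightarrow> ('e set \<Rightarrow> bool) \<Rightarrow> real" where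
  "cube_prob X p P = cube_expectation X p (\<lambda>S. of_bool (P S))"

definition increasing_event :: "('e set \<Rightarrow> bool) \<Rightarrow> bool" where
  "increasing_event P \<longleftrightarrow> (\<forall>S S'. S \<subseteq> S' \<longrightarrow> P S \<longrightarrow> P S')"

lemma increasing_eventI: "(\<And>S S'. S \<subseteq> S' \<Longrightarrow> P S \<Longrightarrow> P S') \<Longrightarrow> increasing_event P"
  by (auto simp: increasing_event_def)

lemma increasing_eventD: "increasing_event P \<Longrightarrow> S \<subseteq> S' \<Longrightarrow> P S \<Longrightarrow> P S'"
  by (auto simp: increasing_event_def)

lemma increasing_event_insert: "increasing_event P \<Longrightarrow> increasing_event (\<lambda>S. P (insert x S))"
proof (rule increasing_eventI)
  fix S S' assume "increasing_event P" "S \<subseteq> S'" "P (insert x S)"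
  then show "P (insert x S')" using increasing_eventD[of P "insert x S" "insert x S'"] by blast
qed

lemma cube_expectation_empty [simp]: "cube_expectation {} p f = f {}"
  by (simp add: cube_expectation_def)

lemma cube_expectation_insert:
  assumes "finite X" "x \<notin> X"
  shows "cube_expectation (insert x X) p f =
    p * cube_expectation X p (\<lambda>S. f (insert x S)) + (1 - p) * cube_expectation X p f"
proof -
  have inj: "inj_on (insert x) (Pow X)"
    using assms(2) by (auto simp: inj_on_def insert_ident)
  have disj: "Pow X \<inter> insert x ` Pow X = {}"
    using assms(2) by auto
  have "cube_expectation (insert x X) p f =
      (\<Sum>S\<in>Pow X. p ^ card S * (1 - p) ^ card (insert x X - S) * f S) +
      (\<Sum>S\<in>Pow X. p ^ card (insert x S) * (1 - p) ^ card (insert x X - insert x S) * f (insert x S))"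
    unfolding cube_expectation_def Pow_insert
    using assms(1) disj inj by (simp add: sum.union_disjoint sum.reindex)
  also have "(\<Sum>S\<in>Pow X. p ^ card S * (1 - p) ^ card (insert x X - S) * f S) =
      (1 - p) * cube_expectation X p f"
    unfolding cube_expectation_def sum_distrib_left
  proof (rule sum.cong[OF refl])
    fix S assume S: "S \<in> Pow X"
    then have "insert x X - S = insert x (X - S)" using assms(2) by auto
    then have "card (insert x X - S) = Suc (card (X - S))"
      using assms by (simp add: finite_Diff)
    then show "p ^ card S * (1 - p) ^ card (insert x X - S) * f S =
        (1 - p) * (p ^ card S * (1 - p) ^ card (X - S) * f S)" by simp
  qed
  also have "(\<Sum>S\<in>Pow X. p ^ card (insert x S) * (1 - p) ^ card (insert x X - insert x S) * f (insert x S)) =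
      p * cube_expectation X p (\<lambda>S. f (insert x S))"
    unfolding cube_expectation_def sum_distrib_left
  proof (rule sum.cong[OF refl])
    fix S assume S: "S \<in> Pow X"
    then have "finite S" "x \<notin> S" using assms by (auto intro: finite_subset)
    moreover have "insert x X - insert x S = X - S" using assms(2) by auto
    ultimately show "p ^ card (insert x S) * (1 - p) ^ card (insert x X - insert x S) * f (insert x S) =
        p * (p ^ card S * (1 - p) ^ card (X - S) * f (insert x S))" by simp
  qed
  finally show ?thesis by simp
qed

lemma cube_expectation_add:
  "cube_expectation X p (\<lambda>S. f S + g S) = cube_expectation X p f + cube_expectation X p g"
  by (simp add: cube_expectation_def sum.distrib algebra_simps)

lemma cube_expectation_cmult:
  "cube_expectation X p (\<lambda>S. c * f S) = c * cube_expectation X p f"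
  by (simp add: cube_expectation_def sum_distrib_left algebra_simps)

lemma cube_expectation_sum:
  "cube_expectation X p (\<lambda>S. \<Sum>i\<in>I. f i S) = (\<Sum>i\<in>I. cube_expectation X p (f i))"
  unfolding cube_expectation_def sum_distrib_left by (rule sum.swap)

lemma cube_expectation_cong:
  assumes "\<And>S. S \<subseteq> X \<Longrightarrow> f S = g S"
  shows "cube_expectation X p f = cube_expectation X p g"
  unfolding cube_expectation_def using assms by (intro sum.cong) auto

lemma cube_expectation_mono:
  assumes "0 \<le> p" "p \<le> 1" "\<And>S. S \<subseteq> X \<Longrightarrow> f S \<le> g S"
  shows "cube_expectation X p f \<le> cube_expectation X p g"
  unfolding cube_expectation_def using assms by (intro sum_mono mult_left_mono) auto

lemma cube_expectation_const: "finite X \<Longrightarrow> cube_expectation X p (\<lambda>S. c) = c"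
  by (induction X rule: finite_induct) (simp_all add: cube_expectation_insert algebra_simps)

lemma cube_prob_mono:
  assumes "0 \<le> p" "p \<le> 1" "\<And>S. S \<subseteq> X \<Longrightarrow> P S \<Longrightarrow> Q S"
  shows "cube_prob X p P \<le> cube_prob X p Q"
  unfolding cube_prob_def by (rule cube_expectation_mono) (use assms in auto)

lemma cube_prob_cong:
  assumes "\<And>S. S \<subseteq> X \<Longrightarrow> P S = Q S"
  shows "cube_prob X p P = cube_prob X p Q"
  unfolding cube_prob_def by (rule cube_expectation_cong) (use assms in auto)

lemma cube_prob_nonneg: "0 \<le> p \<Longrightarrow> p \<le> 1 \<Longrightarrow> 0 \<le> cube_prob X p P"
  unfolding cube_prob_def cube_expectation_def by (intro sum_nonneg) auto

lemma cube_prob_True: "finite X \<Longrightarrow> (\<And>S. S \<subseteq> X \<Longrightarrow> P S) \<Longrightarrow> cube_prob X p P = 1"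
  using cube_prob_cong[of X P "\<lambda>_. True" p] by (simp add: cube_prob_def cube_expectation_const)

lemma cube_prob_union_bound:
  assumes "0 \<le> p" "p \<le> 1" "\<And>S. S \<subseteq> X \<Longrightarrow> P S \<Longrightarrow> Q S \<or> Q' S"
  shows "cube_prob X p P \<le> cube_prob X p Q + cube_prob X p Q'"
  unfolding cube_prob_def cube_expectation_add[symmetric]
  by (rule cube_expectation_mono) (use assms in \<open>auto simp: of_bool_def\<close>)

lemma cube_prob_insert:
  assumes "finite X" "x \<notin> X"
  shows "cube_prob (insert x X) p P =
    p * cube_prob X p (\<lambda>S. P (insert x S)) + (1 - p) * cube_prob X p P"
  unfolding cube_prob_def using cube_expectation_insert[OF assms] by simp

lemma cube_prob_disjoint_sum_le_1:
  assumes "finite X" "0 \<le> p" "p \<le> 1" "finite I"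
    and disj: "\<And>i j S. \<lbrakk>i \<in> I; j \<in> I; S \<subseteq> X; P i S; P j S\<rbrakk> \<Longrightarrow> i = j"
  shows "(\<Sum>i\<in>I. cube_prob X p (P i)) \<le> 1"
proof -
  have "(\<Sum>i\<in>I. of_bool (P i S) :: real) \<le> 1" if "S \<subseteq> X" for S
  proof (cases "\<exists>i\<in>I. P i S")
    case True
    then obtain i where i: "i \<in> I" "P i S" by blast
    have "(\<Sum>j\<in>I. of_bool (P j S) :: real) = (\<Sum>j\<in>I. if j = i then 1 else 0)"
      by (rule sum.cong) (use i disj[OF _ _ that] in auto)
    then show ?thesis using i assms(4) by simp
  qed auto
  then have "cube_expectation X p (\<lambda>S. \<Sum>i\<in>I. of_bool (P i S)) \<le> cube_expectation X p (\<lambda>S. 1)"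
    by (intro cube_expectation_mono assms)
  then show ?thesis
    by (simp add: cube_prob_def cube_expectation_sum cube_expectation_const assms(1))
qed

lemma cube_prob_indep:
  assumes "finite X" "finite R" "R \<inter> X = {}"
  shows "cube_prob (R \<union> X) p (\<lambda>S. P (S \<inter> R) \<and> Q (S - R)) = cube_prob R p P * cube_prob X p Q"
  using assms(2,3)
proof (induction R arbitrary: P rule: finite_induct)
  case empty
  then show ?case by (cases "P {}") (simp_all add: cube_prob_def cube_expectation_def)
next
  case (insert x R)
  have eq: "cube_prob (R \<union> X) p (\<lambda>S. P' (S \<inter> insert x R) \<and> Q (S - insert x R)) =
     cube_prob (R \<union> X) p (\<lambda>S. P' (S \<inter> R) \<and> Q (S - R))" for P'
    by (rule cube_prob_cong) (use insert.hyps insert.prems in \<open>auto simp: Diff_insert0 Int_insert_right\<close>)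
  have eq2: "cube_prob (R \<union> X) p (\<lambda>S. P (insert x S \<inter> insert x R) \<and> Q (insert x S - insert x R)) =
     cube_prob (R \<union> X) p (\<lambda>S. P (insert x (S \<inter> R)) \<and> Q (S - R))"
  proof (rule cube_prob_cong)
    fix S assume S: "S \<subseteq> R \<union> X"
    then have "insert x S \<inter> insert x R = insert x (S \<inter> R)" "insert x S - insert x R = S - R"
      using insert.hyps insert.prems by auto
    then show "(P (insert x S \<inter> insert x R) \<and> Q (insert x S - insert x R)) =
      (P (insert x (S \<inter> R)) \<and> Q (S - R))" by simp
  qed
  have fin: "finite (R \<union> X)" "x \<notin> R \<union> X" using insert.hyps insert.prems assms(1) by auto
  have "cube_prob (insert x R \<union> X) p (\<lambda>S. P (S \<inter> insert x R) \<and> Q (S - insert x R)) =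
    p * cube_prob (R \<union> X) p (\<lambda>S. P (insert x (S \<inter> R)) \<and> Q (S - R)) +
    (1 - p) * cube_prob (R \<union> X) p (\<lambda>S. P (S \<inter> R) \<and> Q (S - R))"
    unfolding Un_insert_left cube_prob_insert[OF fin] eq eq2 ..
  also have "\<dots> = cube_prob (insert x R) p P * cube_prob X p Q"
    using insert.IH[of "\<lambda>S. P (insert x S)"] insert.IH[of P] insert.hyps insert.prems
    by (simp add: cube_prob_insert algebra_simps)
  finally show ?case .
qed

lemma cube_prob_marginal:
  assumes "finite X" "R \<subseteq> X"
  shows "cube_prob X p (\<lambda>S. P (S \<inter> R)) = cube_prob R p P"
proof -
  have X: "R \<union> (X - R) = X" using assms(2) by auto
  have "finite R" using assms finite_subset by blast
  then show ?thesis
    using cube_prob_indep[of "X - R" R p P "\<lambda>_. True", unfolded X] assms(1)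
    by (simp add: cube_prob_True)
qed

lemma cube_prob_all_closed: "finite X \<Longrightarrow> cube_prob X p (\<lambda>S. S = {}) = (1 - p) ^ card X"
  by (induction X rule: finite_induct)
     (simp_all add: cube_prob_insert, simp_all add: cube_prob_def cube_expectation_def)

lemma cube_prob_superset:
  assumes "finite X" "B \<subseteq> X"
  shows "cube_prob X p (\<lambda>S. B \<subseteq> S) = p ^ card B"
proof -
  have fB: "finite B" using assms finite_subset by blast
  have "cube_prob X p (\<lambda>S. B \<subseteq> S) = cube_prob X p (\<lambda>S. B \<subseteq> S \<inter> B)"
    by (rule cube_prob_cong) auto
  also have "\<dots> = cube_prob B p (\<lambda>S. B \<subseteq> S)"
    using assms by (rule cube_prob_marginal)
  also have "\<dots> = cube_prob B p (\<lambda>S. S = B)" by (rule cube_prob_cong) auto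
  also have "\<dots> = (\<Sum>S\<in>Pow B. if S = B then p ^ card B else 0)"
    unfolding cube_prob_def cube_expectation_def by (rule sum.cong) auto
  also have "\<dots> = p ^ card B" using fB by simp
  finally show ?thesis .
qed

text \<open>Given the state of one edge \<open>x\<close> the inequality holds by induction.  Averaging the product of the
  two conditional probabilities over \<open>x\<close> exceeds the product of their averages by \<open>p (1 - p)\<close> times the product of
  the increments caused by opening \<open>x\<close>, which are nonnegative.\<close>

lemma harris_inequality:
  assumes "finite X" "0 \<le> p" "p \<le> 1" "increasing_event P" "increasing_event Q"
  shows "cube_prob X p P * cube_prob X p Q \<le> cube_prob X p (\<lambda>S. P S \<and> Q S)"
  using assms(1,4,5)
proof (induction X arbitrary: P Q rule: finite_induct)
  case empty
  then show ?case by (simp add: cube_prob_def)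
next
  case (insert x X)
  define P1 where "P1 = (\<lambda>S. P (insert x S))"
  define Q1 where "Q1 = (\<lambda>S. Q (insert x S))"
  let ?a1 = "cube_prob X p P1" and ?a0 = "cube_prob X p P"
  let ?b1 = "cube_prob X p Q1" and ?b0 = "cube_prob X p Q"
  have inc: "increasing_event P1" "increasing_event Q1"
    using insert.prems[THEN increasing_event_insert, of x] by (simp_all add: P1_def Q1_def)
  have mono: "cube_prob X p P' \<le> cube_prob X p (\<lambda>S. P' (insert x S))" if "increasing_event P'" for P'
    using cube_prob_mono[OF assms(2,3)] increasing_eventD[OF that subset_insertI] by metis
  have "?a0 \<le> ?a1" "?b0 \<le> ?b1"
    unfolding P1_def Q1_def by (rule mono[OF insert.prems(1)], rule mono[OF insert.prems(2)])
  then have "0 \<le> p * (1 - p) * ((?a1 - ?a0) * (?b1 - ?b0))"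
    using assms(2,3) by auto
  then have "(p * ?a1 + (1 - p) * ?a0) * (p * ?b1 + (1 - p) * ?b0) \<le>
      p * (?a1 * ?b1) + (1 - p) * (?a0 * ?b0)"
    by (simp add: algebra_simps)
  also have "\<dots> \<le> p * cube_prob X p (\<lambda>S. P1 S \<and> Q1 S) + (1 - p) * cube_prob X p (\<lambda>S. P S \<and> Q S)"
    using insert.IH[OF inc] insert.IH[OF insert.prems] assms(2,3)
    by (intro add_mono mult_left_mono) auto
  finally show ?case
    using insert.hyps by (simp add: cube_prob_insert P1_def Q1_def)
qed

lemma harris_inequality_Ball:
  assumes "finite X" "0 \<le> p" "p \<le> 1" "finite I" "0 \<le> c"
    and "\<And>i. i \<in> I \<Longrightarrow> increasing_event (P i)" "\<And>i. i \<in> I \<Longrightarrow> c \<le> cube_prob X p (P i)"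
  shows "c ^ card I \<le> cube_prob X p (\<lambda>S. \<forall>i\<in>I. P i S)"
  using assms(4,6,7)
proof (induction I rule: finite_induct)
  case empty
  then show ?case using assms(1) by (simp add: cube_prob_True)
next
  case (insert i I)
  have "c * c ^ card I \<le> cube_prob X p (P i) * cube_prob X p (\<lambda>S. \<forall>i\<in>I. P i S)"
    using insert by (intro mult_mono) (auto intro!: cube_prob_nonneg zero_le_power assms)
  also have "\<dots> \<le> cube_prob X p (\<lambda>S. P i S \<and> (\<forall>i\<in>I. P i S))"
  proof (rule harris_inequality[OF assms(1-3)])
    show "increasing_event (\<lambda>S. \<forall>i\<in>I. P i S)"
      using insert.prems(1) unfolding increasing_event_def by (meson insertCI)
  qed (use insert.prems in auto)
  finally show ?case using insert.hyps by simp
qed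

text \<open>The union of independent configurations of densities \<open>p\<close> and \<open>\<epsilon>\<close> has density
  \<open>p + \<epsilon> (1 - p)\<close>.\<close>

lemma cube_expectation_sprinkle:
  assumes "finite X"
  shows "cube_expectation X (p + \<epsilon> * (1 - p)) f =
    cube_expectation X p (\<lambda>S. cube_expectation X \<epsilon> (\<lambda>S'. f (S \<union> S')))"
  using assms
proof (induction X arbitrary: f rule: finite_induct)
  case empty
  then show ?case by simp
next
  case (insert x X)
  show ?case
    using insert.hyps
    by (simp add: cube_expectation_insert insert.IH cube_expectation_add cube_expectation_cmult)
       (simp add: algebra_simps)
qed

text \<open>Finite energy, with the entropy of the choice of \<open>B\<close> taken care of by sprinkling: the missing edges
  are chosen as a function of the first configuration, and the sprinkled edges, being
  independent of it, contain them with probability at least \<open>\<epsilon>\<^sup>m\<close>.\<close>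

lemma cube_prob_sprinkle:
  assumes X: "finite X" and p: "0 \<le> p" "p \<le> 1" and e: "0 \<le> \<epsilon>" "\<epsilon> \<le> 1" and U: "increasing_event U"
  shows "\<epsilon> ^ m * cube_prob X p (\<lambda>S. \<exists>B\<subseteq>X. card B \<le> m \<and> U (S \<union> B)) \<le> cube_prob X (p + \<epsilon> * (1 - p)) U"
  unfolding cube_prob_def cube_expectation_sprinkle[OF X] cube_expectation_cmult[symmetric]
proof (rule cube_expectation_mono[OF p])
  fix S assume "S \<subseteq> X"
  show "\<epsilon> ^ m * of_bool (\<exists>B\<subseteq>X. card B \<le> m \<and> U (S \<union> B)) \<le>
      cube_expectation X \<epsilon> (\<lambda>S'. of_bool (U (S \<union> S')))"
  proof (cases "\<exists>B\<subseteq>X. card B \<le> m \<and> U (S \<union> B)")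
    case True
    then obtain B where B: "B \<subseteq> X" "card B \<le> m" "U (S \<union> B)" by blast
    have "\<epsilon> ^ m \<le> \<epsilon> ^ card B" using B e by (intro power_decreasing)
    also have "\<dots> = cube_prob X \<epsilon> (\<lambda>S'. B \<subseteq> S')"
      using X B(1) by (rule cube_prob_superset[symmetric])
    also have "\<dots> \<le> cube_prob X \<epsilon> (\<lambda>S'. U (S \<union> S'))"
    proof (rule cube_prob_mono[OF e])
      fix S' assume "B \<subseteq> S'"
      then have "S \<union> B \<subseteq> S \<union> S'" by blast
      then show "U (S \<union> S')" using U B(3) increasing_eventD by blast
    qed
    finally show ?thesis using True by (simp add: cube_prob_def)
  next
    case False
    then have "of_bool (\<exists>B\<subseteq>X. card B \<le> m \<and> U (S \<union> B)) = (0 :: real)" by simp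
    then show ?thesis
      using cube_prob_nonneg[OF e, of X "\<lambda>S'. U (S \<union> S')"] by (simp only: cube_prob_def mult_zero_right)
  qed
qed

lemma cube_prob_mono_param:
  assumes X: "finite X" and p: "0 \<le> p" "p \<le> q" "q \<le> 1" and U: "increasing_event U"
  shows "cube_prob X p U \<le> cube_prob X q U"
proof (cases "p = 1")
  case False
  define e where "e = (q - p) / (1 - p)"
  have e: "0 \<le> e" "e \<le> 1" "q = p + e * (1 - p)" using p False by (auto simp: e_def field_simps)
  have "cube_prob X p U \<le> e ^ 0 * cube_prob X p (\<lambda>S. \<exists>B\<subseteq>X. card B \<le> 0 \<and> U (S \<union> B))"
    using p by (auto intro!: cube_prob_mono exI[of _ "{}"])
  also have "\<dots> \<le> cube_prob X q U"
    unfolding e(3) using p by (intro cube_prob_sprinkle X e U) auto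
  finally show ?thesis .
qed (use p in simp)

text \<open>Here \<open>R S\<close> is the set of edges whose states an exploration of \<open>S\<close> has revealed; the hypothesis
  on it says that \<open>R\<close> is a stopping set, determined by the states of the edges in it, and that \<open>P\<close>
  is decided by then.  Conditionally on what has been revealed, the other edges are a fresh sample.\<close>

lemma cube_prob_strong_markov:
  assumes X: "finite X" and p: "0 \<le> p" "p \<le> 1"
    and R: "\<And>S. R S \<subseteq> X"
    and stop: "\<And>S S'. \<lbrakk>S \<subseteq> X; S' \<subseteq> X; S' \<inter> R S = S \<inter> R S\<rbrakk> \<Longrightarrow> R S' = R S \<and> (P S \<longrightarrow> P S')"
    and fresh: "\<And>S. \<lbrakk>S \<subseteq> X; P S\<rbrakk> \<Longrightarrow> c \<le> cube_prob X p (\<lambda>S'. Q (S \<inter> R S \<union> (S' - R S)))"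
  shows "c * cube_prob X p P \<le> cube_prob X p Q"
proof -
  \<comment> \<open>What the exploration has revealed; its values partition the configurations.\<close>
  define key where "key = (\<lambda>S. (R S, S \<inter> R S))"
  define I where "I = key ` {S \<in> Pow X. P S}"
  have finI: "finite I" using X by (simp add: I_def)
  have local: "c * cube_prob X p (\<lambda>S. key S = i) \<le> cube_prob X p (\<lambda>S. key S = i \<and> Q S)"
    if i: "i \<in> I" for i
  proof -
    obtain S0 where S0: "S0 \<subseteq> X" "P S0" "i = key S0" using i unfolding I_def by blast
    let ?R = "R S0"
    have XR: "?R \<union> (X - ?R) = X" using R by blast
    have finR: "finite ?R" using R X finite_subset by blast
    have key: "key S = i \<longleftrightarrow> S \<inter> ?R = S0 \<inter> ?R" if "S \<subseteq> X" for S
      using stop[OF S0(1) that] by (auto simp: key_def S0(3))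
    have "cube_prob X p (\<lambda>S. key S = i \<and> Q S) =
        cube_prob (?R \<union> (X - ?R)) p (\<lambda>S. S \<inter> ?R = S0 \<inter> ?R \<and> Q (S0 \<inter> ?R \<union> (S - ?R)))"
      unfolding XR
    proof (rule cube_prob_cong)
      fix S assume S: "S \<subseteq> X"
      have "S \<inter> ?R = S0 \<inter> ?R \<Longrightarrow> S0 \<inter> ?R \<union> (S - ?R) = S" by blast
      then show "(key S = i \<and> Q S) = (S \<inter> ?R = S0 \<inter> ?R \<and> Q (S0 \<inter> ?R \<union> (S - ?R)))"
        using key[OF S] by auto
    qed
    also have "\<dots> = cube_prob ?R p (\<lambda>S. S = S0 \<inter> ?R) * cube_prob (X - ?R) p (\<lambda>S. Q (S0 \<inter> ?R \<union> S))"
      by (rule cube_prob_indep) (use X finR in auto)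
    also have "cube_prob ?R p (\<lambda>S. S = S0 \<inter> ?R) = cube_prob X p (\<lambda>S. key S = i)"
      using cube_prob_marginal[OF X R, of p "\<lambda>S. S = S0 \<inter> ?R"] cube_prob_cong[of X _ _ p, OF key] by simp
    also have "cube_prob (X - ?R) p (\<lambda>S. Q (S0 \<inter> ?R \<union> S)) =
        cube_prob X p (\<lambda>S. Q (S0 \<inter> ?R \<union> (S \<inter> (X - ?R))))"
      by (rule cube_prob_marginal[symmetric]) (use X in auto)
    also have "\<dots> = cube_prob X p (\<lambda>S. Q (S0 \<inter> ?R \<union> (S - ?R)))"
    proof (rule cube_prob_cong)
      fix S assume "S \<subseteq> X"
      then have "S \<inter> (X - ?R) = S - ?R" by blast
      then show "Q (S0 \<inter> ?R \<union> S \<inter> (X - ?R)) = Q (S0 \<inter> ?R \<union> (S - ?R))" by simp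
    qed
    finally have eq: "cube_prob X p (\<lambda>S. key S = i \<and> Q S) =
      cube_prob X p (\<lambda>S. key S = i) * cube_prob X p (\<lambda>S. Q (S0 \<inter> ?R \<union> (S - ?R)))" .
    show ?thesis
      unfolding eq using fresh[OF S0(1,2)] cube_prob_nonneg[OF p]
      by (subst mult.commute) (rule mult_left_mono)
  qed
  have split: "of_bool (P S \<and> Q' S) = (\<Sum>i\<in>I. of_bool (key S = i \<and> Q' S) :: real)"
    if "S \<subseteq> X" for S Q'
  proof -
    have "P S \<longleftrightarrow> key S \<in> I"
    proof
      assume "key S \<in> I"
      then obtain S0 where "S0 \<subseteq> X" "P S0" "key S = key S0" by (auto simp: I_def)
      then show "P S" using stop[of S0 S] that by (auto simp: key_def)
    qed (use that in \<open>auto simp: I_def\<close>)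
    moreover have "(\<Sum>i\<in>I. of_bool (key S = i \<and> Q' S) :: real) = (\<Sum>i\<in>I. if i = key S then of_bool (Q' S) else 0)"
      by (rule sum.cong) auto
    ultimately show ?thesis using finI by auto
  qed
  have split_prob: "cube_prob X p (\<lambda>S. P S \<and> Q' S) = (\<Sum>i\<in>I. cube_prob X p (\<lambda>S. key S = i \<and> Q' S))" for Q'
    unfolding cube_prob_def cube_expectation_sum[symmetric]
    by (rule cube_expectation_cong) (rule split)
  have "c * cube_prob X p P = (\<Sum>i\<in>I. c * cube_prob X p (\<lambda>S. key S = i))"
    using split_prob[of "\<lambda>_. True"] by (simp add: sum_distrib_left)
  also have "\<dots> \<le> (\<Sum>i\<in>I. cube_prob X p (\<lambda>S. key S = i \<and> Q S))"
    by (rule sum_mono) (rule local)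
  also have "\<dots> = cube_prob X p (\<lambda>S. P S \<and> Q S)" by (rule split_prob[symmetric])
  also have "\<dots> \<le> cube_prob X p Q" by (rule cube_prob_mono) (use p in auto)
  finally show ?thesis .
qed

section \<open>Clusters and the merging of stranded clusters\<close>

lemma adj_sym: "(x, y) \<in> adj F \<Longrightarrow> (y, x) \<in> adj F"
  by (simp add: adj_def insert_commute)

lemma component_refl [simp]: "v \<in> component F v"
  by (simp add: component_def)

lemma component_trans: "w \<in> component F v \<Longrightarrow> x \<in> component F w \<Longrightarrow> x \<in> component F v"
  by (auto simp: component_def)

lemma component_sym: "w \<in> component F v \<Longrightarrow> v \<in> component F w"
proof -
  have "sym (adj F)" by (auto intro: symI adj_sym)
  then show "w \<in> component F v \<Longrightarrow> v \<in> component F w"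
    unfolding component_def by (auto dest: symD[OF sym_rtrancl])
qed

lemma component_eq: "w \<in> component F v \<Longrightarrow> component F w = component F v"
  by (auto intro: component_trans component_sym)

lemma component_edge: "{u, w} \<in> F \<Longrightarrow> w \<in> component F u"
  by (auto simp: component_def adj_def)

lemma component_mono: "F \<subseteq> F' \<Longrightarrow> component F v \<subseteq> component F' v"
  using rtrancl_mono[of "adj F" "adj F'"] by (auto simp: component_def adj_def)

lemma component_induct [consumes 1, case_names start step]:
  assumes "w \<in> component F v" "P v"
    and "\<And>a b. a \<in> component F v \<Longrightarrow> {a, b} \<in> F \<Longrightarrow> P a \<Longrightarrow> P b"
  shows "P w"
  using assms(1) unfolding component_def mem_Collect_eq
proof (induction rule: rtrancl_induct)
  case (step a b)
  then show ?case using assms(3)[of a b] by (auto simp: component_def adj_def)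
qed (rule assms(2))

lemma component_backward_induct [consumes 1, case_names final step]:
  assumes "w \<in> component F v" "P w"
    and "\<And>a b. a \<in> component F v \<Longrightarrow> {a, b} \<in> F \<Longrightarrow> P b \<Longrightarrow> P a"
  shows "P v"
proof -
  have v: "v \<in> component F w" by (rule component_sym[OF assms(1)])
  show ?thesis
    using v
  proof (induction rule: component_induct)
    case (step a b)
    then show ?case
      using assms(3)[of b a] component_eq[OF assms(1)] component_edge[of a b F]
      by (auto simp: insert_commute intro: component_trans)
  qed (rule assms(2))
qed

lemma component_crossing:
  assumes "w \<in> component F v" "P w" "\<not> P v"
  obtains a b where "a \<in> component F v" "{a, b} \<in> F" "\<not> P a" "P b"
proof (rule ccontr)
  assume "\<not> thesis"
  then have step: "\<And>a b. \<lbrakk>a \<in> component F v; {a, b} \<in> F; \<not> P a\<rbrakk> \<Longrightarrow> \<not> P b"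
    using that by blast
  have "\<not> P w"
    using assms(1,3) by (induction rule: component_induct) (use step in blast)+
  then show False using assms(2) by blast
qed

lemma component_subset_closed:
  assumes "u \<in> A" and "\<And>a b. a \<in> A \<Longrightarrow> {a, b} \<in> F \<Longrightarrow> b \<in> A \<and> {a, b} \<in> F'"
  shows "component F u \<subseteq> component F' u \<inter> A"
proof
  fix w assume "w \<in> component F u"
  then show "w \<in> component F' u \<inter> A"
  proof (induction rule: component_induct)
    case (step a b)
    then show ?case using assms(2)[of a b] component_edge[of a b F'] by (auto intro: component_trans)
  qed (use assms(1) in simp)
qed

definition joins :: "'a set set \<Rightarrow> 'a set \<Rightarrow> 'a set \<Rightarrow> bool" where
  "joins S Z W \<longleftrightarrow> (\<exists>z\<in>Z. component S z \<inter> W \<noteq> {})"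

lemma joins_mono: "S \<subseteq> S' \<Longrightarrow> joins S Z W \<Longrightarrow> joins S' Z W"
  unfolding joins_def using component_mono[of S S'] by blast

lemma joins_increasing: "increasing_event (\<lambda>S. joins S Z W)"
  by (rule increasing_eventI) (rule joins_mono)

text \<open>In the application \<open>X\<close> consists of the edges that avoid the cut-off component \<open>A\<close> and meet the
  large finite set \<open>B\<close>, \<open>Y\<close> of the outer endpoints of the cutset, and \<open>T\<close> stands for infinity.\<close>

locale terminals =
  fixes X :: "'a set set" and Y T :: "'a set"
  assumes finite_X: "finite X" and finite_Y: "finite Y"
begin

definition reached :: "'a set set \<Rightarrow> 'a set" where
  "reached S = {u. component S u \<inter> (Y \<union> T) \<noteq> {}}"

definition revealed :: "'a set set \<Rightarrow> 'a set set" where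
  "revealed S = {e \<in> X. e \<inter> reached S \<noteq> {}}"

definition stranded :: "'a set set \<Rightarrow> 'a set set" where
  "stranded S = component S ` {y \<in> Y. component S y \<inter> T = {}}"

lemma terminals_reached: "Y \<union> T \<subseteq> reached S"
proof
  fix u assume "u \<in> Y \<union> T"
  then have "u \<in> component S u \<inter> (Y \<union> T)" by simp
  then show "u \<in> reached S" unfolding reached_def by blast
qed

lemma reached_closed: "u \<in> reached S \<Longrightarrow> w \<in> component S u \<Longrightarrow> w \<in> reached S"
  unfolding reached_def using component_eq[of w S u] by simp

lemma stranded_subset_reached: "Z \<in> stranded S \<Longrightarrow> Z \<subseteq> reached S"
  using terminals_reached[of S] by (auto simp: stranded_def intro: reached_closed)

lemma finite_stranded: "finite (stranded S)"
  using finite_Y by (simp add: stranded_def)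

lemma card_stranded_le: "card (stranded S) \<le> card Y"
  unfolding stranded_def using finite_Y
  by (intro order.trans[OF card_image_le card_mono]) auto

lemma stranded_empty_iff: "stranded S = {} \<longleftrightarrow> (\<forall>y\<in>Y. component S y \<inter> T \<noteq> {})"
  by (auto simp: stranded_def)

text \<open>A cluster of \<open>Y \<union> T\<close> is recognised by its open edges together with the closed edges at its vertices,
  and all of these touch \<open>reached S\<close>.\<close>

lemma exploration_is_stopping:
  assumes "S \<subseteq> X" "S' \<subseteq> X" "S' \<inter> revealed S = S \<inter> revealed S"
  shows "reached S' = reached S" "revealed S' = revealed S" "stranded S' = stranded S"
proof -
  have comp: "component S' u = component S u" if u: "u \<in> reached S" for u
  proof
    show "component S u \<subseteq> component S' u"
    proof (rule order.trans[OF component_subset_closed[where A = "reached S" and F' = S']])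
      fix a b assume ab: "a \<in> reached S" "{a, b} \<in> S"
      then have "{a, b} \<in> revealed S" using assms(1) by (auto simp: revealed_def)
      then have "{a, b} \<in> S'" using ab(2) assms(3) by blast
      then show "b \<in> reached S \<and> {a, b} \<in> S'"
        using reached_closed[OF ab(1) component_edge[OF ab(2)]] by simp
    qed (use u in auto)
    show "component S' u \<subseteq> component S u"
    proof (rule order.trans[OF component_subset_closed[where A = "reached S" and F' = S]])
      fix a b assume ab: "a \<in> reached S" "{a, b} \<in> S'"
      then have "{a, b} \<in> revealed S" using assms(2) by (auto simp: revealed_def)
      then have S: "{a, b} \<in> S" using ab(2) assms(3) by blast
      then show "b \<in> reached S \<and> {a, b} \<in> S"
        using reached_closed[OF ab(1) component_edge[OF S]] by simp
    qed (use u in auto)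
  qed
  show reached: "reached S' = reached S"
  proof
    show "reached S \<subseteq> reached S'"
      using comp unfolding reached_def by auto
    show "reached S' \<subseteq> reached S"
    proof
      fix u assume "u \<in> reached S'"
      then obtain t where t: "t \<in> component S' u" "t \<in> Y \<union> T" by (auto simp: reached_def)
      then have tr: "t \<in> reached S" using terminals_reached by blast
      have "u \<in> component S t" using component_sym[OF t(1)] comp[OF tr] by simp
      then show "u \<in> reached S" using tr reached_closed by blast
    qed
  qed
  show "revealed S' = revealed S" by (simp add: revealed_def reached)
  have "component S' y = component S y" if "y \<in> Y" for y
    using that terminals_reached comp by blast
  then show "stranded S' = stranded S" by (auto simp: stranded_def image_iff)
qed

text \<open>Follow a path of \<open>S\<close> from \<open>Z\<close> to another explored cluster, from its last vertex in \<open>Z\<close> to the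
  first explored vertex after that.  In between it uses only edges that were not
  revealed, so \<open>S1\<close> lacks at most the first and the last edge of this piece.\<close>

lemma joins_after_resampling:
  fixes S0 S :: "'a set set"
  defines "S1 \<equiv> S0 \<inter> revealed S0 \<union> (S - revealed S0)"
  assumes S: "S \<subseteq> X" and joins: "joins S Z (reached S0 - Z)" and Z: "Z \<subseteq> reached S0"
  shows "\<exists>B\<subseteq>X. card B \<le> 2 \<and> joins (S1 \<union> B) Z (reached S0 - Z)"
    (is ?goal)
proof -
  let ?C = "reached S0"
  let ?ext = "\<lambda>a. \<exists>e\<in>X. component (insert e S1) a \<inter> (?C - Z) \<noteq> {}"
  obtain z w where z: "z \<in> Z" and w: "w \<in> component S z" "w \<in> ?C - Z"
    using joins by (auto simp: joins_def)
  \<comment> \<open>Backward along the path, the claim for a vertex not yet explored is that one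
  revealed edge suffices to continue to another explored cluster; crossing back into
  \<open>Z\<close> adds the second edge and settles the goal.\<close>
  have "?goal \<or> z \<in> ?C - Z \<or> z \<notin> ?C \<and> ?ext z"
    using w(1)
  proof (induction rule: component_backward_induct)
    case (step a b)
    have ab: "{a, b} \<in> X" using step.hyps S by blast
    have fresh: "{a, b} \<in> S1" if "a \<notin> ?C" "b \<notin> ?C"
      using step.hyps that by (auto simp: S1_def revealed_def)
    have b: "b \<in> component F a" if "{a, b} \<in> F" for F using that by (rule component_edge)
    consider ?goal | "a \<in> ?C - Z" | "a \<in> Z" "b \<in> ?C - Z" | e where "a \<in> Z" "b \<notin> ?C" "e \<in> X" "component (insert e S1) b \<inter> (?C - Z) \<noteq> {}"
      | "a \<notin> ?C" "b \<in> ?C - Z" | e where "a \<notin> ?C" "b \<notin> ?C" "e \<in> X" "component (insert e S1) b \<inter> (?C - Z) \<noteq> {}"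
      using step.IH by blast
    then show ?case
    proof cases
      case 3
      then have "joins (S1 \<union> {{a, b}}) Z (?C - Z)" unfolding joins_def using b by blast
      then have ?goal using ab by (intro exI[of _ "{{a, b}}"]) auto
      then show ?thesis ..
    next
      case (4 e)
      have "component (insert e S1) b \<subseteq> component (S1 \<union> {{a, b}, e}) b"
        by (rule component_mono) auto
      then have "component (S1 \<union> {{a, b}, e}) a \<inter> (?C - Z) \<noteq> {}"
        using 4(4) component_eq[OF b, of "S1 \<union> {{a, b}, e}"] by auto
      then have "joins (S1 \<union> {{a, b}, e}) Z (?C - Z)" unfolding joins_def using 4(1) by blast
      moreover have "card {{a, b}, e} \<le> 2" by (simp add: card_insert_if)
      ultimately have ?goal using ab 4(3) by (intro exI[of _ "{{a, b}, e}"]) auto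
      then show ?thesis ..
    next
      case 5
      then have "component (insert {a, b} S1) a \<inter> (?C - Z) \<noteq> {}" using b by blast
      then show ?thesis using 5 ab by blast
    next
      case (6 e)
      have "component (insert e S1) a = component (insert e S1) b"
        using component_eq[OF b, of "insert e S1"] fresh[OF 6(1,2)] by auto
      then show ?thesis using 6 by blast
    qed blast+
  qed (use w in blast)
  then show ?thesis using z Z by blast
qed

text \<open>A stranded cluster of \<open>S2\<close> contains a stranded cluster of \<open>S1\<close>, which was joined to another explored
  cluster; as this one misses \<open>T\<close> too, every stranded cluster of \<open>S2\<close> contains two of \<open>S1\<close>.\<close>

lemma merging_halves_stranded:
  assumes "S1 \<subseteq> S2" and joined: "\<And>Z. Z \<in> stranded S1 \<Longrightarrow> joins S2 Z (reached S1 - Z)"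
  shows "2 * card (stranded S2) \<le> card (stranded S1)"
proof -
  let ?sub = "\<lambda>Z2. {Z \<in> stranded S1. Z \<subseteq> Z2}"
  have fin: "finite (?sub Z2)" for Z2 using finite_stranded by simp
  have two: "2 \<le> card (?sub Z2)" if Z2: "Z2 \<in> stranded S2" for Z2
  proof -
    obtain y where y: "y \<in> Y" "Z2 = component S2 y" "Z2 \<inter> T = {}"
      using Z2 by (auto simp: stranded_def)
    have le: "component S1 u \<subseteq> component S2 u" for u using assms(1) by (rule component_mono)
    let ?Z = "component S1 y"
    have Zsub: "?Z \<subseteq> Z2" using y le by blast
    then have Z: "?Z \<in> stranded S1" using y unfolding stranded_def by blast
    obtain z w where zw: "z \<in> ?Z" "w \<in> component S2 z" "w \<in> reached S1" "w \<notin> ?Z"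
      using joined[OF Z] by (auto simp: joins_def)
    have "w \<in> Z2" using zw(1,2) Zsub y(2) component_trans by fast
    then have w2: "component S2 w = Z2" using component_eq y(2) by fast
    obtain t where t: "t \<in> component S1 w" "t \<in> Y \<union> T" using zw(3) by (auto simp: reached_def)
    have tZ2: "t \<in> Z2" using t(1) le w2 by blast
    then have tY: "t \<in> Y" using t(2) y(3) by blast
    have t2: "component S2 t = Z2" using tZ2 component_eq y(2) by fast
    let ?Z' = "component S1 t"
    have Z'sub: "?Z' \<subseteq> Z2" using le t2 by blast
    then have Z': "?Z' \<in> stranded S1" using tY y(3) unfolding stranded_def by blast
    have "w \<in> ?Z'" using component_sym[OF t(1)] .
    then have "?Z \<noteq> ?Z'" using zw(4) by blast
    then have "card {?Z, ?Z'} = 2" by simp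
    moreover have "{?Z, ?Z'} \<subseteq> ?sub Z2" using Z Z' Zsub Z'sub by blast
    ultimately show ?thesis using card_mono[OF fin[of Z2], of "{?Z, ?Z'}"] by simp
  qed
  have disj: "?sub A \<inter> ?sub B = {}" if AB: "A \<in> stranded S2" "B \<in> stranded S2" "A \<noteq> B" for A B
  proof (rule ccontr)
    assume "?sub A \<inter> ?sub B \<noteq> {}"
    then obtain Z where Z: "Z \<in> stranded S1" "Z \<subseteq> A" "Z \<subseteq> B" by blast
    then obtain y where y: "Z = component S1 y" by (auto simp: stranded_def)
    have "y \<in> A" "y \<in> B" using Z(2,3) component_refl[of y S1] unfolding y by blast+
    moreover obtain a b where "A = component S2 a" "B = component S2 b"
      using AB(1,2) by (auto simp: stranded_def)
    ultimately have "A = component S2 y" "B = component S2 y"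
      using component_eq[of y S2] by auto
    then show False using AB(3) by simp
  qed
  have "2 * card (stranded S2) \<le> (\<Sum>Z2\<in>stranded S2. card (?sub Z2))"
    using sum_mono[of "stranded S2" "\<lambda>_. 2" "\<lambda>Z2. card (?sub Z2)"] two by simp
  also have "\<dots> = card (\<Union>Z2\<in>stranded S2. ?sub Z2)"
    by (rule card_UN_disjoint[symmetric]) (use finite_stranded fin disj in auto)
  also have "\<dots> \<le> card (stranded S1)" by (rule card_mono[OF finite_stranded]) auto
  finally show ?thesis .
qed

lemma merging_after_resampling:
  fixes S0 S :: "'a set set"
  defines "S1 \<equiv> S0 \<inter> revealed S0 \<union> (S - revealed S0)"
  assumes S: "S0 \<subseteq> X" "S \<subseteq> X"
    and joins: "\<And>Z. Z \<in> stranded S0 \<Longrightarrow> joins S Z (reached S0 - Z)"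
  shows "\<exists>B\<subseteq>X. card B \<le> 2 * card (stranded S0) \<and> 2 * card (stranded (S1 \<union> B)) \<le> card (stranded S0)"
proof -
  have rev: "revealed S0 \<subseteq> X" by (auto simp: revealed_def)
  have "S1 \<subseteq> X" using S by (auto simp: S1_def)
  moreover have "S1 \<inter> revealed S0 = S0 \<inter> revealed S0" by (auto simp: S1_def)
  ultimately have same: "reached S1 = reached S0" "stranded S1 = stranded S0"
    using exploration_is_stopping[OF S(1), of S1] by simp_all
  have "\<exists>B\<subseteq>X. card B \<le> 2 \<and> joins (S1 \<union> B) Z (reached S0 - Z)" if "Z \<in> stranded S0" for Z
    using joins_after_resampling[OF S(2) joins[OF that] stranded_subset_reached[OF that]]
    by (simp add: S1_def)
  then obtain B where B: "\<And>Z. Z \<in> stranded S0 \<Longrightarrow>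
      B Z \<subseteq> X \<and> card (B Z) \<le> 2 \<and> joins (S1 \<union> B Z) Z (reached S0 - Z)"
    by metis
  let ?B = "\<Union>Z\<in>stranded S0. B Z"
  have "card ?B \<le> (\<Sum>Z\<in>stranded S0. card (B Z))"
    using finite_stranded by (rule card_UN_le)
  also have "\<dots> \<le> 2 * card (stranded S0)"
    using sum_mono[of "stranded S0" "\<lambda>Z. card (B Z)" "\<lambda>_. 2"] B by simp
  finally have "card ?B \<le> 2 * card (stranded S0)" .
  moreover have "2 * card (stranded (S1 \<union> ?B)) \<le> card (stranded S1)"
  proof (rule merging_halves_stranded)
    fix Z assume "Z \<in> stranded S1"
    then have Z: "Z \<in> stranded S0" by (simp add: same)
    have "S1 \<union> B Z \<subseteq> S1 \<union> ?B" using Z by blast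
    then show "joins (S1 \<union> ?B) Z (reached S1 - Z)"
      using B[OF Z] joins_mono unfolding same by blast
  qed simp
  ultimately show ?thesis using B same by (intro exI[of _ ?B]) auto
qed

lemma card_stranded_increasing: "increasing_event (\<lambda>S. card (stranded S) \<le> k)"
proof (rule increasing_eventI)
  fix S S' :: "'a set set" assume SS': "S \<subseteq> S'" and k: "card (stranded S) \<le> k"
  have le: "component S u \<subseteq> component S' u" for u using SS' by (rule component_mono)
  have "stranded S' \<subseteq> (\<lambda>Z. \<Union>z\<in>Z. component S' z) ` stranded S"
  proof
    fix Z' assume "Z' \<in> stranded S'"
    then obtain y where y: "y \<in> Y" "Z' = component S' y" "Z' \<inter> T = {}" by (auto simp: stranded_def)
    then have y': "component S y \<in> stranded S" using le unfolding stranded_def by blast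
    have "(\<Union>z\<in>component S y. component S' z) = Z'"
    proof -
      have "component S' z = Z'" if "z \<in> component S y" for z
        unfolding y(2) by (rule component_eq[OF subsetD[OF le that]])
      moreover have "component S y \<noteq> {}" using component_refl[of y S] by fast
      ultimately show ?thesis by auto
    qed
    from this[symmetric] y' show "Z' \<in> (\<lambda>Z. \<Union>z\<in>Z. component S' z) ` stranded S"
      by (rule image_eqI)
  qed
  then have "card (stranded S') \<le> card (stranded S)"
    by (rule surj_card_le[OF finite_stranded])
  then show "card (stranded S') \<le> k" using k by simp
qed

end

section \<open>Connecting all terminals at exponential cost\<close>

lemma joins_singleton: "joins S {u} W \<longleftrightarrow> component S u \<inter> W \<noteq> {}"
  by (simp add: joins_def)

text \<open>The density after \<open>i\<close> sprinklings of densities \<open>2\<^sup>-\<^sup>2, 2\<^sup>-\<^sup>3, \<dots>\<close>.  These sum to \<open>1/2\<close>, so the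
  probability of being closed stays at least half of what it was at the start.\<close>

primrec sprinkled_density :: "real \<Rightarrow> nat \<Rightarrow> real" where
  "sprinkled_density p 0 = p"
| "sprinkled_density p (Suc i) =
    sprinkled_density p i + (1 / 2) ^ (i + 2) * (1 - sprinkled_density p i)"

lemma sprinkled_density_upper:
  assumes "p \<le> 1"
  shows "(1 - p) * (1 / 2 + (1 / 2) ^ (i + 1)) \<le> 1 - sprinkled_density p i"
proof (induction i)
  case (Suc i)
  define x :: real where "x = (1 / 2) ^ (i + 1)"
  have x: "0 \<le> x" "x \<le> 1 / 2"
    using power_decreasing[of 1 "i + 1" "1 / 2 :: real"] by (auto simp: x_def)
  have "x * x \<le> x * (1 / 2)" using x by (intro mult_left_mono)
  then have "1 / 2 + x / 2 \<le> (1 - x / 2) * (1 / 2 + x)" by (simp add: algebra_simps)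
  then have "(1 - p) * (1 / 2 + x / 2) \<le> (1 - p) * ((1 - x / 2) * (1 / 2 + x))"
    using assms by (intro mult_left_mono) auto
  also have "\<dots> = (1 - x / 2) * ((1 - p) * (1 / 2 + x))" by simp
  also have "\<dots> \<le> (1 - x / 2) * (1 - sprinkled_density p i)"
    using Suc x by (intro mult_left_mono) (auto simp: x_def)
  also have "\<dots> = 1 - sprinkled_density p (Suc i)" by (simp add: x_def algebra_simps)
  finally show ?case by (simp add: x_def)
qed simp

lemma sprinkled_density_bounds:
  assumes "p \<le> 1"
  shows "p \<le> sprinkled_density p i" "sprinkled_density p i \<le> (1 + p) / 2" "sprinkled_density p i \<le> 1"
proof -
  have "(1 - p) * (1 / 2) \<le> (1 - p) * (1 / 2 + (1 / 2) ^ (i + 1))" for i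
    using assms by (intro mult_left_mono) auto
  also have "\<dots> i \<le> 1 - sprinkled_density p i" for i
    using assms by (rule sprinkled_density_upper)
  finally have *: "sprinkled_density p i \<le> (1 + p) / 2" for i
    by (simp add: field_simps)
  have "(1 + p) / 2 \<le> 1" using assms by simp
  then have le1: "sprinkled_density p i \<le> 1" for i by (rule order.trans[OF *])
  show "sprinkled_density p i \<le> (1 + p) / 2" "sprinkled_density p i \<le> 1" by (rule * le1)+
  show "p \<le> sprinkled_density p i"
  proof (induction i)
    case (Suc i)
    have "0 \<le> (1 / 2) ^ (i + 2) * (1 - sprinkled_density p i)"
      using le1[of i] by (intro mult_nonneg_nonneg) auto
    then show ?case using Suc by simp
  qed simp
qed

context terminals
begin

text \<open>Each vertex that can be reached from \<open>y\<close> is joined with probability at least \<open>\<theta> / 2\<close> to \<open>Z\<close> or else to \<open>W\<close>.  On a path from \<open>y \<in> Z\<close>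
  to \<open>T \<subseteq> W\<close> consider the edge \<open>{a, b}\<close> where \<open>W\<close> becomes likely: then \<open>Z\<close> is likely at \<open>a\<close>, \<open>W\<close> is likely at
  \<open>b\<close>, and Harris' inequality combines these connections with the edge.\<close>

lemma join_probability:
  assumes p: "0 \<le> p" "p \<le> 1" and \<theta>: "0 \<le> \<theta>" "\<theta> \<le> 1"
    and reach: "\<And>u. u \<in> component X y \<Longrightarrow> \<theta> \<le> cube_prob X p (\<lambda>S. joins S {u} (Y \<union> T))"
    and escape: "component X y \<inter> T \<noteq> {}"
    and ZW: "y \<in> Z" "Y \<union> T \<subseteq> Z \<union> W" "T \<subseteq> W"
  shows "p * (\<theta> / 2)\<^sup>2 \<le> cube_prob X p (\<lambda>S. joins S Z W)"
proof (cases "\<theta> / 2 \<le> cube_prob X p (\<lambda>S. joins S {y} W)")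
  case True
  have "p * (\<theta> / 2)\<^sup>2 \<le> 1 * (1 * (\<theta> / 2))"
    unfolding power2_eq_square using p \<theta> by (intro mult_mono) auto
  also have "\<dots> \<le> cube_prob X p (\<lambda>S. joins S {y} W)" using True by simp
  also have "\<dots> \<le> cube_prob X p (\<lambda>S. joins S Z W)"
    using p ZW(1) by (intro cube_prob_mono) (auto simp: joins_def)
  finally show ?thesis .
next
  case False
  obtain t where t: "t \<in> component X y" "t \<in> T" using escape by blast
  have "joins S {t} W" for S using t(2) ZW(3) component_refl[of t S] unfolding joins_def by blast
  then have "cube_prob X p (\<lambda>S. joins S {t} W) = 1" using finite_X by (simp add: cube_prob_True)
  then have "\<theta> / 2 \<le> cube_prob X p (\<lambda>S. joins S {t} W)" using \<theta> by simp
  then obtain a b where ab: "a \<in> component X y" "{a, b} \<in> X"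
    "\<not> \<theta> / 2 \<le> cube_prob X p (\<lambda>S. joins S {a} W)" "\<theta> / 2 \<le> cube_prob X p (\<lambda>S. joins S {b} W)"
    using component_crossing[OF t(1), of "\<lambda>u. \<theta> / 2 \<le> cube_prob X p (\<lambda>S. joins S {u} W)"] False by blast
  have "\<theta> \<le> cube_prob X p (\<lambda>S. joins S {a} (Y \<union> T))" by (rule reach[OF ab(1)])
  also have "\<dots> \<le> cube_prob X p (\<lambda>S. joins S {a} Z) + cube_prob X p (\<lambda>S. joins S {a} W)"
    using ZW(2) by (intro cube_prob_union_bound p) (auto simp: joins_def)
  finally have aZ: "\<theta> / 2 \<le> cube_prob X p (\<lambda>S. joins S {a} Z)" using ab(3) by simp
  have edge: "cube_prob X p (\<lambda>S. {a, b} \<in> S) = p"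
    using cube_prob_superset[OF finite_X, of "{{a, b}}" p] ab(2) by simp
  have inc: "increasing_event (\<lambda>S. {a, b} \<in> S)" by (auto intro: increasing_eventI)
  have inc2: "increasing_event (\<lambda>S. joins S {a} Z \<and> joins S {b} W)"
    by (rule increasing_eventI) (auto intro: joins_mono)
  have "p * (\<theta> / 2)\<^sup>2 \<le> p * (cube_prob X p (\<lambda>S. joins S {a} Z) * cube_prob X p (\<lambda>S. joins S {b} W))"
    unfolding power2_eq_square using p \<theta> aZ ab(4) by (intro mult_left_mono mult_mono) auto
  also have "\<dots> \<le> p * cube_prob X p (\<lambda>S. joins S {a} Z \<and> joins S {b} W)"
    using p by (intro mult_left_mono harris_inequality finite_X joins_increasing)
  also have "\<dots> \<le> cube_prob X p (\<lambda>S. {a, b} \<in> S \<and> (joins S {a} Z \<and> joins S {b} W))"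
    using harris_inequality[OF finite_X p inc inc2] by (simp add: edge)
  also have "\<dots> \<le> cube_prob X p (\<lambda>S. joins S Z W)"
  proof (rule cube_prob_mono[OF p])
    fix S assume S: "{a, b} \<in> S \<and> (joins S {a} Z \<and> joins S {b} W)"
    then obtain z where z: "z \<in> Z" "z \<in> component S a" by (auto simp: joins_def)
    have "component S z = component S b"
      using component_eq[OF z(2)] component_eq[OF component_edge[of a b S]] S by simp
    then show "joins S Z W" using S z(1) by (auto simp: joins_def)
  qed
  finally show ?thesis .
qed

text \<open>The fresh configuration that the exploration leaves behind joins all stranded clusters with probability at least
  \<open>c\<^sup>k\<close>, and the sprinkling supplies the at most \<open>2 k\<close> revealed closed edges that these
  connections need.\<close>

lemma merging_round:
  assumes p: "0 \<le> p" "p \<le> 1" and \<epsilon>: "0 \<le> \<epsilon>" "\<epsilon> \<le> 1" and c: "0 \<le> c" "c \<le> 1"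
    and join: "\<And>y Z W. \<lbrakk>y \<in> Y; y \<in> Z; Y \<union> T \<subseteq> Z \<union> W; T \<subseteq> W\<rbrakk> \<Longrightarrow>
      c \<le> cube_prob X p (\<lambda>S. joins S Z W)"
  shows "(\<epsilon>\<^sup>2 * c) ^ k * cube_prob X p (\<lambda>S. card (stranded S) \<le> k) \<le>
    cube_prob X (p + \<epsilon> * (1 - p)) (\<lambda>S. card (stranded S) \<le> k div 2)"
proof -
  let ?few = "\<lambda>S. card (stranded S) \<le> k div 2"
  have "c ^ k * cube_prob X p (\<lambda>S. card (stranded S) \<le> k) \<le>
      cube_prob X p (\<lambda>S. \<exists>B\<subseteq>X. card B \<le> 2 * k \<and> ?few (S \<union> B))"
  proof (rule cube_prob_strong_markov[OF finite_X p, where R = revealed])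
    show "revealed S \<subseteq> X" for S by (auto simp: revealed_def)
    show "revealed S' = revealed S \<and> (card (stranded S) \<le> k \<longrightarrow> card (stranded S') \<le> k)"
      if "S \<subseteq> X" "S' \<subseteq> X" "S' \<inter> revealed S = S \<inter> revealed S" for S S'
      using exploration_is_stopping[OF that] by simp
    fix S0 assume S0: "S0 \<subseteq> X" "card (stranded S0) \<le> k"
    let ?J = "\<lambda>S. \<forall>Z\<in>stranded S0. joins S Z (reached S0 - Z)"
    have "c ^ k \<le> c ^ card (stranded S0)" using S0(2) c by (intro power_decreasing)
    also have "\<dots> \<le> cube_prob X p ?J"
    proof (rule harris_inequality_Ball[OF finite_X p finite_stranded c(1) joins_increasing])
      fix Z assume "Z \<in> stranded S0"
      then obtain y where y: "y \<in> Y" "Z = component S0 y" "Z \<inter> T = {}" by (auto simp: stranded_def)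
      show "c \<le> cube_prob X p (\<lambda>S. joins S Z (reached S0 - Z))"
        using terminals_reached[of S0] y by (intro join[OF y(1)]) auto
    qed
    also have "\<dots> \<le> cube_prob X p (\<lambda>S. \<exists>B\<subseteq>X. card B \<le> 2 * k \<and>
        ?few (S0 \<inter> revealed S0 \<union> (S - revealed S0) \<union> B))"
    proof (rule cube_prob_mono[OF p])
      fix S assume S: "S \<subseteq> X" "?J S"
      then obtain B where B: "B \<subseteq> X" "card B \<le> 2 * card (stranded S0)"
          "2 * card (stranded (S0 \<inter> revealed S0 \<union> (S - revealed S0) \<union> B)) \<le> card (stranded S0)"
        using merging_after_resampling[OF S0(1) S(1)] by blast
      show "\<exists>B\<subseteq>X. card B \<le> 2 * k \<and> ?few (S0 \<inter> revealed S0 \<union> (S - revealed S0) \<union> B)"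
        using B S0(2) by (intro exI[of _ B]) auto
    qed
    finally show "c ^ k \<le> cube_prob X p (\<lambda>S. \<exists>B\<subseteq>X. card B \<le> 2 * k \<and>
        ?few (S0 \<inter> revealed S0 \<union> (S - revealed S0) \<union> B))" .
  qed
  then have "\<epsilon> ^ (2 * k) * (c ^ k * cube_prob X p (\<lambda>S. card (stranded S) \<le> k)) \<le>
      \<epsilon> ^ (2 * k) * cube_prob X p (\<lambda>S. \<exists>B\<subseteq>X. card B \<le> 2 * k \<and> ?few (S \<union> B))"
    using \<epsilon> by (intro mult_left_mono) auto
  also have "\<dots> \<le> cube_prob X (p + \<epsilon> * (1 - p)) ?few"
    by (rule cube_prob_sprinkle[OF finite_X p \<epsilon> card_stranded_increasing])
  finally show ?thesis by (simp add: power_mult_distrib power_mult mult.assoc)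
qed

text \<open>With \<open>k\<^sub>i = \<lfloor>n / 2\<^sup>i\<rfloor>\<close> the rounds cost the factors \<open>(4\<^sup>-\<^sup>i\<^sup>-\<^sup>2 c)\<close> to the power \<open>k\<^sub>i\<close>.  The product is kept under
  control by a potential: since \<open>2 k\<^sub>i\<^sub>+\<^sub>1 \<le> k\<^sub>i\<close>, we have \<open>k\<^sub>i \<le> 2 k\<^sub>i - 2 k\<^sub>i\<^sub>+\<^sub>1\<close> and
  \<open>(i + 2) k\<^sub>i \<le> (2 i + 6) k\<^sub>i - (2 i + 8) k\<^sub>i\<^sub>+\<^sub>1\<close>, so the exponents of \<open>c\<close> and \<open>1/4\<close> telescope
  to at most \<open>2 n\<close> and \<open>6 n\<close>.\<close>

lemma connection_probability:
  assumes p: "0 < p" "p < 1" and \<theta>: "0 < \<theta>" "\<theta> \<le> 1"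
    and reach: "\<And>y u. \<lbrakk>y \<in> Y; u \<in> component X y\<rbrakk> \<Longrightarrow> \<theta> \<le> cube_prob X p (\<lambda>S. joins S {u} (Y \<union> T))"
    and escape: "\<And>y. y \<in> Y \<Longrightarrow> component X y \<inter> T \<noteq> {}"
  shows "((p * (\<theta> / 2)\<^sup>2)\<^sup>2 / 4 ^ 6) ^ card Y \<le>
    cube_prob X ((1 + p) / 2) (\<lambda>S. \<forall>y\<in>Y. component S y \<inter> T \<noteq> {})"
proof -
  define n where "n = card Y"
  define c where "c = p * (\<theta> / 2)\<^sup>2"
  define q where "q = sprinkled_density p"
  define P where "P = (\<lambda>i. cube_prob X (q i) (\<lambda>S. card (stranded S) \<le> n div 2 ^ i))"
  have q: "p \<le> q i" "q i \<le> (1 + p) / 2" "0 \<le> q i" "q i \<le> 1" for i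
    using sprinkled_density_bounds[of p i] p by (auto simp: q_def)
  have c: "0 \<le> c" "c \<le> 1"
    using p \<theta> mult_mono[of p 1 "(\<theta> / 2)\<^sup>2" 1] power_le_one[of "\<theta> / 2" 2] by (auto simp: c_def)
  have P0: "0 \<le> P i" for i unfolding P_def using q by (intro cube_prob_nonneg)
  have join: "c \<le> cube_prob X (q i) (\<lambda>S. joins S Z W)"
    if "y \<in> Y" "y \<in> Z" "Y \<union> T \<subseteq> Z \<union> W" "T \<subseteq> W" for i y Z W
  proof -
    have "c \<le> cube_prob X p (\<lambda>S. joins S Z W)"
      unfolding c_def using p \<theta> by (intro join_probability[where y = y] reach[OF that(1)] escape that) auto
    also have "\<dots> \<le> cube_prob X (q i) (\<lambda>S. joins S Z W)"
      using p q by (intro cube_prob_mono_param finite_X joins_increasing) auto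
    finally show ?thesis .
  qed
  have round: "((1 / 4) ^ (i + 2) * c) ^ (n div 2 ^ i) * P i \<le> P (Suc i)" for i
  proof -
    have "(((1 / 2) ^ (i + 2))\<^sup>2 * c) ^ (n div 2 ^ i) * P i \<le>
        cube_prob X (q i + (1 / 2) ^ (i + 2) * (1 - q i)) (\<lambda>S. card (stranded S) \<le> n div 2 ^ i div 2)"
      unfolding P_def using q c by (intro merging_round join power_le_one) auto
    moreover have "((1 / 2) ^ (i + 2))\<^sup>2 = (1 / 4 :: real) ^ (i + 2)"
      unfolding power_mult[symmetric] mult.commute[of _ 2] by (simp add: power_mult power2_eq_square)
    moreover have "n div 2 ^ i div 2 = n div 2 ^ Suc i"
      by (simp add: div_mult2_eq[symmetric] mult.commute)
    moreover have "q i + (1 / 2) ^ (i + 2) * (1 - q i) = q (Suc i)" by (simp add: q_def)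
    ultimately show ?thesis by (simp only: P_def)
  qed
  have invariant: "c ^ (2 * n) * (1 / 4) ^ (6 * n) \<le>
      P i * (c ^ (2 * (n div 2 ^ i)) * (1 / 4) ^ ((2 * i + 6) * (n div 2 ^ i)))" for i
  proof (induction i)
    case 0
    have "P 0 = 1"
      unfolding P_def using finite_X card_stranded_le by (simp add: cube_prob_True n_def)
    then show ?case by simp
  next
    case (Suc i)
    define k where "k = n div 2 ^ i"
    define k' where "k' = n div 2 ^ Suc i"
    have "k' = k div 2" by (simp add: k_def k'_def div_mult2_eq[symmetric] mult.commute)
    then have k': "2 * k' \<le> k" by simp
    have "(2 * Suc i + 6) * k' = (i + 4) * (2 * k')" by (simp add: algebra_simps)
    also have "\<dots> \<le> (i + 4) * k" using k' by (intro mult_left_mono) auto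
    finally have e: "(2 * Suc i + 6) * k' \<le> (i + 4) * k" .
    have "c ^ (2 * k) = c ^ k * c ^ k" by (simp add: mult_2 power_add)
    moreover have "(2 * i + 6) * k = (i + 2) * k + (i + 4) * k" by (simp add: algebra_simps)
    then have "(1 / 4 :: real) ^ ((2 * i + 6) * k) = ((1 / 4) ^ (i + 2)) ^ k * (1 / 4) ^ ((i + 4) * k)"
      by (simp only: power_add power_mult)
    ultimately have "P i * (c ^ (2 * k) * (1 / 4) ^ ((2 * i + 6) * k)) =
        (((1 / 4) ^ (i + 2) * c) ^ k * P i) * (c ^ k * (1 / 4) ^ ((i + 4) * k))"
      by (simp only: power_mult_distrib mult_ac)
    also have "\<dots> \<le> P (Suc i) * (c ^ (2 * k') * (1 / 4) ^ ((2 * Suc i + 6) * k'))"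
    proof (intro mult_mono)
      show "((1 / 4) ^ (i + 2) * c) ^ k * P i \<le> P (Suc i)" unfolding k_def by (rule round)
      show "c ^ k \<le> c ^ (2 * k')" by (rule power_decreasing[OF k' c])
      show "(1 / 4 :: real) ^ ((i + 4) * k) \<le> (1 / 4) ^ ((2 * Suc i + 6) * k')"
        by (rule power_decreasing[OF e]) auto
    qed (use c P0 in auto)
    finally show ?case using Suc by (simp only: k_def k'_def)
  qed
  \<comment> \<open>After \<open>n\<close> rounds no stranded cluster is left.\<close>
  have zero: "n div 2 ^ n = 0" using less_exp[of n] by simp
  have "((p * (\<theta> / 2)\<^sup>2)\<^sup>2 / 4 ^ 6) ^ card Y = c ^ (2 * n) * (1 / 4) ^ (6 * n)"
  proof -
    have "(p * (\<theta> / 2)\<^sup>2)\<^sup>2 / 4 ^ 6 = c\<^sup>2 * (1 / 4) ^ 6" by (simp add: c_def power_one_over)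
    then show ?thesis by (simp only: n_def power_mult power_mult_distrib)
  qed
  also have "\<dots> \<le> P n" using invariant[of n] by (simp add: zero)
  also have "\<dots> \<le> cube_prob X ((1 + p) / 2) (\<lambda>S. card (stranded S) \<le> n div 2 ^ n)"
    unfolding P_def using p q by (intro cube_prob_mono_param finite_X card_stranded_increasing) auto
  also have "\<dots> = cube_prob X ((1 + p) / 2) (\<lambda>S. \<forall>y\<in>Y. component S y \<inter> T \<noteq> {})"
    unfolding zero using finite_stranded by (intro cube_prob_cong) (simp add: stranded_empty_iff)
  finally show ?thesis .
qed

end

section \<open>Minimal cutsets of an infinite graph\<close>

definition touching :: "'a set set \<Rightarrow> 'a set \<Rightarrow> 'a set set" where
  "touching E B = {e \<in> E. e \<inter> B \<noteq> {}}"

definition edge_boundary :: "'a set set \<Rightarrow> 'a set \<Rightarrow> 'a set set" where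
  "edge_boundary E A = {e \<in> E. e \<inter> A \<noteq> {} \<and> \<not> e \<subseteq> A}"

definition off_edges :: "'a set set \<Rightarrow> 'a set \<Rightarrow> 'a set set" where
  "off_edges E A = {e \<in> E. e \<inter> A = {}}"

definition outer_endpoints :: "'a set set \<Rightarrow> 'a set \<Rightarrow> 'a set" where
  "outer_endpoints E A = {u. u \<notin> A \<and> (\<exists>a\<in>A. {a, u} \<in> E)}"

lemma component_removed_boundary: "u \<in> A \<Longrightarrow> component (E - edge_boundary E A) u \<subseteq> A"
  by (rule order.trans[OF component_subset_closed[where A = A and F' = UNIV]])
     (auto simp: edge_boundary_def)

lemma component_off_edges: "u \<notin> A \<Longrightarrow> component (off_edges E A) u \<inter> A = {}"
  using component_subset_closed[of u "- A" "off_edges E A" UNIV]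
  by (auto simp: off_edges_def)

context infinite_connected_locally_finite_graph
begin

lemma edge_ends:
  assumes "e \<in> E" obtains a b where "e = {a, b}" "a \<in> V" "b \<in> V"
  using edges[OF assms] by blast

lemma edge_in_V: "{a, b} \<in> E \<Longrightarrow> a \<in> V \<and> b \<in> V"
  by (erule edge_ends) (auto simp: doubleton_eq_iff)

lemma component_subset_V:
  assumes "S \<subseteq> E" "u \<in> V" shows "component S u \<subseteq> V"
  using component_subset_closed[of u V S UNIV] assms edge_in_V by blast

lemma finite_touching:
  assumes "finite B" "B \<subseteq> V" shows "finite (touching E B)"
proof (rule finite_subset)
  show "touching E B \<subseteq> (\<Union>b\<in>B. {e \<in> E. b \<in> e})" by (auto simp: touching_def)
  show "finite (\<Union>b\<in>B. {e \<in> E. b \<in> e})" using assms locally_finite by blast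
qed

lemma edge_boundary_edge:
  assumes "e \<in> edge_boundary E A" obtains a b where "e = {a, b}" "a \<in> A" "b \<notin> A"
proof -
  have "e \<in> E" using assms by (simp add: edge_boundary_def)
  then obtain a b where "e = {a, b}" by (rule edge_ends)
  then show thesis using assms that[of a b] that[of b a] by (auto simp: edge_boundary_def insert_commute)
qed

text \<open>The edge boundary of the cut-off component is itself a cutset and is contained in \<open>F\<close>.\<close>

lemma minimal_cutset_eq_edge_boundary:
  assumes F: "minimal_cutset E v F"
  shows "F = edge_boundary E (component (E - F) v)" (is "F = ?bd")
proof -
  let ?A = "component (E - F) v"
  have "?bd \<subseteq> F"
  proof
    fix e assume e: "e \<in> ?bd"
    then obtain a b where ab: "e = {a, b}" "a \<in> ?A" "b \<notin> ?A" by (rule edge_boundary_edge)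
    show "e \<in> F"
    proof (rule ccontr)
      assume "e \<notin> F"
      then have "{a, b} \<in> E - F" using e ab(1) by (simp add: edge_boundary_def)
      then show False using ab(2,3) component_trans[OF ab(2) component_edge] by blast
    qed
  qed
  moreover have "cutset E v ?bd"
  proof -
    have "finite ?A" using F by (simp add: minimal_cutset_def cutset_def)
    then have "finite (component (E - ?bd) v)"
      using finite_subset[OF component_removed_boundary[of v ?A]] by simp
    moreover have "?bd \<subseteq> E" by (auto simp: edge_boundary_def)
    ultimately show ?thesis by (simp add: cutset_def)
  qed
  ultimately show ?thesis using F unfolding minimal_cutset_def by blast
qed

text \<open>A finite component \<open>C\<close> of the exterior of \<open>A\<close> could be added to \<open>A\<close>: the boundary of \<open>A \<union> C\<close>
  is a cutset that lacks the edges of \<open>F\<close> between \<open>A\<close> and \<open>C\<close>.\<close>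

lemma minimal_cutset_exterior_infinite:
  assumes F: "minimal_cutset E v F" and v: "v \<in> V" and u: "u \<in> V" "u \<notin> component (E - F) v"
  shows "infinite (component (off_edges E (component (E - F) v)) u)"
proof
  let ?A = "component (E - F) v"
  let ?C = "component (off_edges E ?A) u"
  assume fin: "finite ?C"
  have CA: "?C \<inter> ?A = {}" using u(2) by (rule component_off_edges)
  have off: "b \<in> ?C" if "a \<in> ?C" "{a, b} \<in> E" "b \<notin> ?A" for a b
  proof -
    have "{a, b} \<in> off_edges E ?A" using that CA by (auto simp: off_edges_def)
    then show ?thesis by (rule component_trans[OF that(1) component_edge])
  qed
  let ?F' = "edge_boundary E (?A \<union> ?C)"
  have sub: "?F' \<subseteq> F"
  proof
    fix e assume e: "e \<in> ?F'"
    then obtain a b where ab: "e = {a, b}" "a \<in> ?A \<union> ?C" "b \<notin> ?A \<union> ?C" by (rule edge_boundary_edge)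
    have "{a, b} \<in> E" using e ab(1) by (simp add: edge_boundary_def)
    then have "a \<in> ?A" using off[of a b] ab(2,3) by blast
    then have "e \<in> edge_boundary E ?A" using ab e by (auto simp: edge_boundary_def)
    then show "e \<in> F" using minimal_cutset_eq_edge_boundary[OF F] by simp
  qed
  have vC: "v \<notin> ?C" using CA component_refl[of v "E - F"] by blast
  have vu: "v \<in> component E u" using u(1) v by (rule connected)
  obtain a b where ab: "{a, b} \<in> E" "a \<in> ?C" "b \<notin> ?C"
    using component_crossing[OF vu, of "\<lambda>x. x \<notin> ?C"] vC component_refl[of u "off_edges E ?A"] by blast
  then have b: "b \<in> ?A" using off by blast
  have "{a, b} \<in> edge_boundary E ?A" using ab b CA by (auto simp: edge_boundary_def)
  then have "{a, b} \<in> F" using minimal_cutset_eq_edge_boundary[OF F] by simp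
  moreover have "{a, b} \<notin> ?F'" using ab b by (simp add: edge_boundary_def)
  ultimately have "?F' \<subset> F" using sub by blast
  moreover have "cutset E v ?F'"
  proof -
    have "finite ?A" using F by (simp add: minimal_cutset_def cutset_def)
    then have "finite (?A \<union> ?C)" using fin by simp
    then have "finite (component (E - ?F') v)"
      using finite_subset[OF component_removed_boundary[of v "?A \<union> ?C"]] by simp
    then show ?thesis by (auto simp: cutset_def edge_boundary_def)
  qed
  ultimately show False using F by (simp add: minimal_cutset_def)
qed

lemma infinite_component_leaves:
  assumes S: "S \<subseteq> E" and u: "u \<in> V" and inf: "infinite (component S u)" and B: "finite B"
  shows "component (touching S B) u \<inter> (V - B) \<noteq> {}"
proof
  let ?C = "component (touching S B) u"
  assume "?C \<inter> (V - B) = {}"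
  moreover have "?C \<subseteq> V" using S u by (intro component_subset_V) (auto simp: touching_def)
  ultimately have CB: "?C \<subseteq> B" by blast
  have "component S u \<subseteq> component (touching S B) u \<inter> ?C"
  proof (rule component_subset_closed)
    fix a b assume ab: "a \<in> ?C" "{a, b} \<in> S"
    then have e: "{a, b} \<in> touching S B" using CB by (auto simp: touching_def)
    then show "b \<in> ?C \<and> {a, b} \<in> touching S B"
      using component_trans[OF ab(1) component_edge[OF e]] by simp
  qed simp
  then have "component S u \<subseteq> B" using CB by blast
  then show False using inf B finite_subset by blast
qed

lemma outer_endpoints_card_le:
  assumes F: "minimal_cutset E v F" "finite F"
  shows "finite (outer_endpoints E (component (E - F) v))"
    and "card (outer_endpoints E (component (E - F) v)) \<le> card F"
proof -
  let ?A = "component (E - F) v"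
  have sub: "outer_endpoints E ?A \<subseteq> (\<lambda>e. the_elem (e - ?A)) ` F"
  proof
    fix u assume "u \<in> outer_endpoints E ?A"
    then obtain a where a: "a \<in> ?A" "u \<notin> ?A" "{a, u} \<in> E" by (auto simp: outer_endpoints_def)
    then have "{a, u} \<in> F"
      by (subst minimal_cutset_eq_edge_boundary[OF F(1)]) (auto simp: edge_boundary_def)
    moreover have "{a, u} - ?A = {u}" using a by auto
    ultimately show "u \<in> (\<lambda>e. the_elem (e - ?A)) ` F" by (intro image_eqI[of _ _ "{a, u}"]) auto
  qed
  show "finite (outer_endpoints E ?A)" using sub F(2) finite_subset by blast
  show "card (outer_endpoints E ?A) \<le> card F" by (rule surj_card_le[OF F(2) sub])
qed

text \<open>This transfers the escape probability of the whole graph to the exterior of \<open>A\<close>: until an open path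
  enters \<open>A\<close> it avoids \<open>A\<close>, and just before entering it is at an outer endpoint.\<close>

lemma first_visit:
  assumes S: "S \<subseteq> touching E B" and u: "u \<notin> A" and reach: "joins S {u} (V - B)"
  shows "joins (S \<inter> (touching E B \<inter> off_edges E A)) {u} (outer_endpoints E A \<union> (V - B))"
proof -
  let ?S = "S \<inter> (touching E B \<inter> off_edges E A)" and ?W = "outer_endpoints E A \<union> (V - B)"
  obtain t where t: "t \<in> component S u" "t \<in> V - B" using reach by (auto simp: joins_def)
  have "u \<in> A \<or> component ?S u \<inter> ?W \<noteq> {}"
    using t(1)
  proof (induction rule: component_backward_induct)
    case final
    then show ?case using t(2) component_refl[of t ?S] by blast
  next
    case (step a b)
    have e: "{a, b} \<in> touching E B" using step.hyps S by blast
    show ?case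
    proof (cases "a \<in> A \<or> b \<in> A")
      case True
      then have "a \<in> A \<or> a \<in> ?W" using e by (auto simp: outer_endpoints_def touching_def insert_commute)
      then show ?thesis using component_refl[of a ?S] by blast
    next
      case False
      then have "{a, b} \<in> ?S" using e step.hyps by (auto simp: off_edges_def touching_def)
      then show ?thesis using False step.IH component_eq[OF component_edge] by metis
    qed
  qed
  then show ?thesis using u by (simp add: joins_singleton)
qed

text \<open>The event that certifies the cutset \<open>F\<close>: counting cutsets amounts to showing that these
  events are disjoint and not too unlikely.\<close>

definition cut_event :: "'a set \<Rightarrow> 'a \<Rightarrow> 'a set set \<Rightarrow> 'a set set \<Rightarrow> bool" where
  "cut_event B v F S \<longleftrightarrow> S \<inter> F = {} \<and>
    (\<forall>y\<in>outer_endpoints E (component (E - F) v).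
      component (S \<inter> (touching E B \<inter> off_edges E (component (E - F) v))) y \<inter> (V - B) \<noteq> {})"

text \<open>Vertices cut off by the closed cutset \<open>F'\<close> are not connected to the complement of \<open>B\<close>, while the
  outer endpoints of \<open>F\<close> are.  So the component cut off by \<open>F'\<close>, which starts at \<open>v\<close>, cannot
  leave the one cut off by \<open>F\<close>, and vice versa.\<close>

lemma cut_events_disjoint:
  assumes F: "minimal_cutset E v F" "component (E - F) v \<subseteq> B"
    and F': "minimal_cutset E v F'" "component (E - F') v \<subseteq> B"
    and S: "S \<subseteq> E" "cut_event B v F S" "cut_event B v F' S"
  shows "F = F'"
proof -
  have sub: "component (E - F') v \<subseteq> component (E - F) v"
    if "component (E - F') v \<subseteq> B" "cut_event B v F S" "cut_event B v F' S" for F F'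
  proof (rule ccontr)
    let ?A = "component (E - F) v" and ?A' = "component (E - F') v"
    assume "\<not> ?A' \<subseteq> ?A"
    then obtain w where w: "w \<in> ?A'" "w \<notin> ?A" by blast
    obtain a b where ab: "a \<in> ?A'" "{a, b} \<in> E - F'" "a \<in> ?A" "b \<notin> ?A"
      using component_crossing[OF w(1), of "\<lambda>x. x \<notin> ?A"] w(2) component_refl[of v "E - F"] by blast
    have bA': "component (E - F') b = ?A'"
      using component_eq[OF component_trans[OF ab(1) component_edge[OF ab(2)]]] .
    have "b \<in> outer_endpoints E ?A" using ab by (auto simp: outer_endpoints_def)
    then have "component (S \<inter> (touching E B \<inter> off_edges E ?A)) b \<inter> (V - B) \<noteq> {}"
      using that(2) by (simp add: cut_event_def)
    moreover have "component (S \<inter> (touching E B \<inter> off_edges E ?A)) b \<subseteq> component (E - F') b"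
      using that(3) S(1) by (intro component_mono) (auto simp: cut_event_def)
    ultimately show False using bA' that(1) by blast
  qed
  have "component (E - F) v = component (E - F') v"
    using sub[OF F'(2) S(2,3)] sub[OF F(2) S(3,2)] by blast
  then show ?thesis
    using minimal_cutset_eq_edge_boundary[OF F(1)] minimal_cutset_eq_edge_boundary[OF F'(1)] by simp
qed

text \<open>The edges of \<open>F\<close> and those avoiding \<open>A\<close> are disjoint sets of edges, so the two halves of the
  event are independent, and the second half is an instance of \<open>connection_probability\<close>.\<close>

lemma cut_event_probability:
  assumes p: "0 < p" "p < 1" and \<theta>: "0 < \<theta>" "\<theta> \<le> 1"
    and escape: "\<And>u. u \<in> V \<Longrightarrow> \<theta> \<le> cube_prob (touching E B) p (\<lambda>S. joins S {u} (V - B))"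
    and F: "minimal_cutset E v F" "finite F" and v: "v \<in> V"
    and B: "finite B" "B \<subseteq> V" "component (E - F) v \<subseteq> B"
  shows "((p * (\<theta> / 2)\<^sup>2)\<^sup>2 / 4 ^ 6 * ((1 - p) / 2)) ^ card F \<le>
    cube_prob (touching E B) ((1 + p) / 2) (cut_event B v F)"
proof -
  let ?A = "component (E - F) v"
  let ?Y = "outer_endpoints E ?A" and ?T = "V - B"
  define X where "X = touching E B \<inter> off_edges E ?A"
  define \<delta> where "\<delta> = (p * (\<theta> / 2)\<^sup>2)\<^sup>2 / 4 ^ 6"
  let ?p = "(1 + p) / 2"
  have p': "0 \<le> ?p" "?p \<le> 1" using p by auto
  have finEB: "finite (touching E B)" using B by (intro finite_touching)
  have X: "finite X" "X \<subseteq> touching E B" using finEB by (auto simp: X_def)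
  interpret terminals X ?Y ?T
    by standard (use X outer_endpoints_card_le[OF F] in auto)
  have bd: "F = edge_boundary E ?A" by (rule minimal_cutset_eq_edge_boundary[OF F(1)])
  have FX: "F \<inter> X = {}" by (subst bd) (auto simp: X_def off_edges_def edge_boundary_def)
  have FE: "F \<subseteq> touching E B" using B(3) by (subst bd) (auto simp: edge_boundary_def touching_def)
  have out: "u \<in> V - ?A" if "y \<in> ?Y" "u \<in> component X y" for u y
  proof -
    have y: "y \<in> V" "y \<notin> ?A" using that(1) edge_in_V by (auto simp: outer_endpoints_def)
    have "component X y \<subseteq> component (off_edges E ?A) y"
      by (rule component_mono) (simp add: X_def)
    then have "u \<notin> ?A" using that(2) component_off_edges[OF y(2)] by blast
    moreover have "component X y \<subseteq> V"
      using y(1) by (intro component_subset_V) (auto simp: X_def touching_def)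
    ultimately show ?thesis using that(2) by blast
  qed
  have "\<delta> ^ card F \<le> \<delta> ^ card ?Y"
  proof (rule power_decreasing)
    have "p * (\<theta> / 2)\<^sup>2 \<le> 1"
      using p \<theta> mult_mono[of p 1 "(\<theta> / 2)\<^sup>2" 1] power_le_one[of "\<theta> / 2" 2] by simp
    then show "\<delta> \<le> 1" using p power_le_one[of "p * (\<theta> / 2)\<^sup>2" 2] by (simp add: \<delta>_def)
  qed (use outer_endpoints_card_le[OF F] in \<open>simp_all add: \<delta>_def\<close>)
  also have "\<dots> \<le> cube_prob X ?p (\<lambda>S. \<forall>y\<in>?Y. component S y \<inter> ?T \<noteq> {})"
    unfolding \<delta>_def
  proof (rule connection_probability[OF p \<theta>])
    fix y u assume yu: "y \<in> ?Y" "u \<in> component X y"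
    have u: "u \<in> V" "u \<notin> ?A" using out[OF yu] by auto
    have "\<theta> \<le> cube_prob (touching E B) p (\<lambda>S. joins S {u} ?T)" by (rule escape[OF u(1)])
    also have "\<dots> \<le> cube_prob (touching E B) p (\<lambda>S. joins (S \<inter> X) {u} (?Y \<union> ?T))"
      unfolding X_def using p u(2) by (intro cube_prob_mono first_visit) auto
    also have "\<dots> = cube_prob X p (\<lambda>S. joins S {u} (?Y \<union> ?T))"
      by (rule cube_prob_marginal[OF finEB X(2)])
    finally show "\<theta> \<le> cube_prob X p (\<lambda>S. joins S {u} (?Y \<union> ?T))" .
  next
    fix y assume "y \<in> ?Y"
    then have y: "y \<in> V" "y \<notin> ?A" using out component_refl by fast+
    have "component (touching (off_edges E ?A) B) y \<inter> ?T \<noteq> {}"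
      using minimal_cutset_exterior_infinite[OF F(1) v y]
      by (intro infinite_component_leaves B(1) y(1)) (auto simp: off_edges_def)
    moreover have "touching (off_edges E ?A) B = X" by (auto simp: X_def touching_def off_edges_def)
    ultimately show "component X y \<inter> ?T \<noteq> {}" by simp
  qed
  finally have conn: "\<delta> ^ card F \<le> cube_prob X ?p (\<lambda>S. \<forall>y\<in>?Y. component S y \<inter> ?T \<noteq> {})" .
  have "(\<delta> * ((1 - p) / 2)) ^ card F = (1 - ?p) ^ card F * \<delta> ^ card F"
  proof -
    have "(1 - p) / 2 = 1 - ?p" by (simp add: field_simps)
    then show ?thesis by (simp only: power_mult_distrib mult.commute)
  qed
  also have "\<dots> \<le> cube_prob F ?p (\<lambda>S. S = {}) * cube_prob X ?p (\<lambda>S. \<forall>y\<in>?Y. component S y \<inter> ?T \<noteq> {})"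
    using conn p by (simp add: cube_prob_all_closed F(2) mult_left_mono)
  also have "\<dots> = cube_prob (F \<union> X) ?p (\<lambda>S. S \<inter> F = {} \<and> (\<forall>y\<in>?Y. component (S - F) y \<inter> ?T \<noteq> {}))"
    by (rule cube_prob_indep[symmetric]) (use X F FX in auto)
  also have "\<dots> = cube_prob (F \<union> X) ?p (cut_event B v F)"
  proof (rule cube_prob_cong)
    fix S assume "S \<subseteq> F \<union> X"
    then have "S - F = S \<inter> X" using FX by blast
    then show "(S \<inter> F = {} \<and> (\<forall>y\<in>?Y. component (S - F) y \<inter> ?T \<noteq> {})) = cut_event B v F S"
      by (simp add: cut_event_def X_def)
  qed
  also have "\<dots> = cube_prob (touching E B) ?p (\<lambda>S. cut_event B v F (S \<inter> (F \<union> X)))"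
    by (rule cube_prob_marginal[symmetric]) (use finEB FE X in auto)
  also have "\<dots> = cube_prob (touching E B) ?p (cut_event B v F)"
  proof (rule cube_prob_cong)
    fix S
    have "S \<inter> (F \<union> X) \<inter> F = S \<inter> F" "S \<inter> (F \<union> X) \<inter> X = S \<inter> X" by auto
    then show "cut_event B v F (S \<inter> (F \<union> X)) = cut_event B v F S"
      by (simp only: cut_event_def X_def)
  qed
  finally show ?thesis by (simp only: \<delta>_def)
qed

lemma card_minimal_cutsets_le:
  assumes p: "0 < p" "p < 1" and \<theta>: "0 < \<theta>" "\<theta> \<le> 1"
    and escape: "\<And>u B. \<lbrakk>u \<in> V; finite B; B \<subseteq> V\<rbrakk> \<Longrightarrow>
      \<theta> \<le> cube_prob (touching E B) p (\<lambda>S. joins S {u} (V - B))"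
    and v: "v \<in> V" and Q: "finite Q" "Q \<subseteq> minimal_cutsets E n v"
  shows "real (card Q) * ((p * (\<theta> / 2)\<^sup>2)\<^sup>2 / 4 ^ 6 * ((1 - p) / 2)) ^ n \<le> 1"
proof -
  let ?\<gamma> = "(p * (\<theta> / 2)\<^sup>2)\<^sup>2 / 4 ^ 6 * ((1 - p) / 2)"
  define B where "B = (\<Union>F\<in>Q. component (E - F) v)"
  have mc: "minimal_cutset E v F" "finite F" "card F = n" if "F \<in> Q" for F
    using that Q(2) by (auto simp: minimal_cutsets_def)
  have B: "finite B" "B \<subseteq> V"
  proof -
    show "finite B"
      unfolding B_def using Q(1) mc(1) by (intro finite_UN_I) (auto simp: minimal_cutset_def cutset_def)
    show "B \<subseteq> V" unfolding B_def using component_subset_V[OF Diff_subset v] by blast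
  qed
  have AB: "component (E - F) v \<subseteq> B" if "F \<in> Q" for F using that by (auto simp: B_def)
  have "real (card Q) * ?\<gamma> ^ n = (\<Sum>F\<in>Q. ?\<gamma> ^ card F)" using mc(3) by simp
  also have "\<dots> \<le> (\<Sum>F\<in>Q. cube_prob (touching E B) ((1 + p) / 2) (cut_event B v F))"
    by (intro sum_mono cut_event_probability[OF p \<theta>] escape B v mc AB)
  also have "\<dots> \<le> 1"
  proof (rule cube_prob_disjoint_sum_le_1)
    show "finite (touching E B)" using B by (rule finite_touching)
    fix F F' S assume "F \<in> Q" "F' \<in> Q" "S \<subseteq> touching E B" "cut_event B v F S" "cut_event B v F' S"
    then show "F = F'"
      using mc(1) AB by (intro cut_events_disjoint[of v F B F' S]) (auto simp: touching_def)
  qed (use p Q in auto)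
  finally show ?thesis .
qed

end

section \<open>The infinite percolation measure and Peierls' argument\<close>

lemma bernoulli_product_prob_space: "product_prob_space (\<lambda>_. measure_pmf (bernoulli_pmf p))"
  by unfold_locales

lemma prob_space_percolation: "prob_space (percolation E p)"
  unfolding percolation_def by (intro prob_space_PiM measure_pmf.prob_space_axioms)

lemma percolation_cylinder:
  assumes p: "0 \<le> p" "p \<le> 1" and X: "X \<subseteq> E" "finite X"
  shows "{\<omega> \<in> space (percolation E p). P {e \<in> X. \<omega> e}} \<in> sets (percolation E p)"
    and "measure (percolation E p) {\<omega> \<in> space (percolation E p). P {e \<in> X. \<omega> e}} = cube_prob X p P"
proof -
  let ?M = "percolation E p"
  interpret product_prob_space "\<lambda>_. measure_pmf (bernoulli_pmf p)" E
    by (rule bernoulli_product_prob_space)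
  define C where "C = (\<lambda>S. {\<omega> \<in> space ?M. \<forall>e\<in>X. \<omega> e \<in> {e \<in> S}})"
  have C_eq: "C S = {\<omega> \<in> space ?M. {e \<in> X. \<omega> e} = S}" if "S \<subseteq> X" for S
    using that by (auto simp: C_def)
  have C_sets: "C S \<in> sets ?M" for S
  proof -
    have "C S = prod_emb E (\<lambda>_. measure_pmf (bernoulli_pmf p)) X (\<Pi>\<^sub>E e\<in>X. {e \<in> S})"
      unfolding C_def percolation_def prod_emb_def using X by (auto simp: space_PiM Pi_iff)
    then show ?thesis
      unfolding percolation_def using X by (auto intro!: sets_PiM_I)
  qed
  have weight: "measure ?M (C S) = p ^ card S * (1 - p) ^ card (X - S)" if S: "S \<subseteq> X" for S
  proof -
    have "emeasure ?M (C S) = (\<Prod>e\<in>X. emeasure (measure_pmf (bernoulli_pmf p)) {e \<in> S})"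
      unfolding C_def percolation_def by (rule emeasure_PiM_Collect) (use X in auto)
    also have "\<dots> = (\<Prod>e\<in>X. ennreal (if e \<in> S then p else 1 - p))"
      using p by (intro prod.cong) (auto simp: emeasure_pmf_single)
    also have "\<dots> = ennreal (\<Prod>e\<in>X. if e \<in> S then p else 1 - p)"
      using p by (intro prod_ennreal) auto
    also have "(\<Prod>e\<in>X. if e \<in> S then p else 1 - p) = p ^ card S * (1 - p) ^ card (X - S)"
    proof -
      have "{e. e \<in> S} \<inter> X = S" "X \<inter> {e. e \<in> S} = S" "X \<inter> - {e. e \<in> S} = X - S" using S by auto
      then show ?thesis using X(2) by (simp add: prod.If_cases)
    qed
    finally show ?thesis using p by (simp add: measure_def)
  qed
  have eq: "{\<omega> \<in> space ?M. P {e \<in> X. \<omega> e}} = (\<Union>S\<in>{S \<in> Pow X. P S}. C S)"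
  proof -
    define f where "f = (\<lambda>\<omega>. {e \<in> X. \<omega> e})"
    have f: "f \<omega> \<subseteq> X" for \<omega> by (auto simp: f_def)
    have "{\<omega> \<in> space ?M. P (f \<omega>)} = (\<Union>S\<in>{S \<in> Pow X. P S}. {\<omega> \<in> space ?M. f \<omega> = S})"
      using f by auto
    also have "\<dots> = (\<Union>S\<in>{S \<in> Pow X. P S}. C S)"
      by (rule SUP_cong[OF refl], subst C_eq) (auto simp: f_def)
    finally show ?thesis by (simp only: f_def)
  qed
  have fin: "finite {S \<in> Pow X. P S}" using X(2) by simp
  show "{\<omega> \<in> space ?M. P {e \<in> X. \<omega> e}} \<in> sets ?M"
    unfolding eq using fin C_sets by blast
  interpret M: prob_space ?M by (rule prob_space_percolation)
  have "measure ?M {\<omega> \<in> space ?M. P {e \<in> X. \<omega> e}} = (\<Sum>S\<in>{S \<in> Pow X. P S}. measure ?M (C S))"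
    unfolding eq
  proof (rule M.finite_measure_finite_Union[OF fin])
    show "disjoint_family_on C {S \<in> Pow X. P S}"
      using C_eq by (auto simp: disjoint_family_on_def)
  qed (use C_sets in blast)
  also have "\<dots> = (\<Sum>S\<in>{S \<in> Pow X. P S}. p ^ card S * (1 - p) ^ card (X - S))"
    by (rule sum.cong) (auto simp: weight)
  also have "\<dots> = cube_prob X p P"
    unfolding cube_prob_def cube_expectation_def
    by (rule sum.mono_neutral_cong_left) (use X(2) in auto)
  finally show "measure ?M {\<omega> \<in> space ?M. P {e \<in> X. \<omega> e}} = cube_prob X p P" .
qed

lemma cube_prob_1: "finite X \<Longrightarrow> cube_prob X 1 P = of_bool (P X)"
proof (induction X arbitrary: P rule: finite_induct)
  case empty
  then show ?case by (simp add: cube_prob_def)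
qed (simp add: cube_prob_insert)

lemma theta_bounds: "0 \<le> theta E v p" "theta E v p \<le> 1"
  unfolding theta_def using prob_space.prob_le_1[OF prob_space_percolation] by auto

context infinite_connected_locally_finite_graph
begin

lemma theta_le_cube_prob:
  assumes p: "0 \<le> p" "p \<le> 1" and u: "u \<in> V" and B: "finite B" "B \<subseteq> V"
  shows "theta E u p \<le> cube_prob (touching E B) p (\<lambda>S. joins S {u} (V - B))"
proof -
  interpret M: prob_space "percolation E p" by (rule prob_space_percolation)
  have X: "touching E B \<subseteq> E" "finite (touching E B)"
    using finite_touching[OF B] by (auto simp: touching_def)
  have "theta E u p \<le> measure (percolation E p)
      {\<omega> \<in> space (percolation E p). joins {e \<in> touching E B. \<omega> e} {u} (V - B)}"
    unfolding theta_def
  proof (rule M.finite_measure_mono[OF _ percolation_cylinder(1)[OF p X]], safe)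
    fix \<omega> assume "infinite (component (open_edges E \<omega>) u)"
    then have "component (touching (open_edges E \<omega>) B) u \<inter> (V - B) \<noteq> {}"
      using u B by (intro infinite_component_leaves) (auto simp: open_edges_def)
    moreover have "touching (open_edges E \<omega>) B = {e \<in> touching E B. \<omega> e}"
      by (auto simp: touching_def open_edges_def)
    ultimately show "joins {e \<in> touching E B. \<omega> e} {u} (V - B)" by (simp add: joins_singleton)
  qed
  also have "\<dots> = cube_prob (touching E B) p (\<lambda>S. joins S {u} (V - B))"
    by (rule percolation_cylinder(2)[OF p X])
  finally show ?thesis .
qed

lemma countable_V: "countable V"
proof -
  obtain v where v: "v \<in> V" using infinite_vertices by fastforce
  have nb: "countable (adj E `` Z)" if "countable Z" for Z
  proof -
    have "countable (adj E `` {z})" for z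
    proof (cases "z \<in> V")
      case True
      have "adj E `` {z} \<subseteq> \<Union> {e \<in> E. z \<in> e}" by (auto simp: adj_def)
      moreover have "finite (\<Union> {e \<in> E. z \<in> e})"
        using locally_finite[OF True] by (auto elim!: edge_ends)
      ultimately show ?thesis using countable_finite finite_subset by metis
    next
      case False
      then have "adj E `` {z} = {}" using edge_in_V by (auto simp: adj_def)
      then show ?thesis by simp
    qed
    moreover have "adj E `` Z = (\<Union>z\<in>Z. adj E `` {z})" by blast
    ultimately show ?thesis using that by simp
  qed
  have "countable ((adj E)\<^sup>* `` {v})" by (rule countable_rtrancl) (use nb in auto)
  moreover have "V \<subseteq> (adj E)\<^sup>* `` {v}" using connected[OF v] by (auto simp: component_def)
  ultimately show ?thesis by (rule countable_subset[rotated])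
qed

text \<open>Whether the cluster of \<open>v\<close> equals a given finite set \<open>A\<close> depends only on the finitely many edges that touch
  \<open>A\<close>, and there are countably many candidates for \<open>A\<close>; this makes the event measurable.\<close>

lemma finite_component_event:
  assumes "v \<in> V"
  shows "{\<omega> \<in> space M. finite (component (open_edges E \<omega>) v)} =
    (\<Union>A\<in>{A. finite A \<and> A \<subseteq> V}. {\<omega> \<in> space M. component {e \<in> touching E A. \<omega> e} v = A})"
proof -
  have loc: "component {e \<in> touching E A. \<omega> e} v = A \<longleftrightarrow> component (open_edges E \<omega>) v = A" for \<omega> A
  proof -
    let ?S = "open_edges E \<omega>" and ?S' = "{e \<in> touching E A. \<omega> e}"
    have sub: "component ?S' v \<subseteq> component ?S v"
      by (rule component_mono) (auto simp: touching_def open_edges_def)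
    show ?thesis
    proof
      assume A: "component ?S' v = A"
      have "component ?S v \<subseteq> component ?S' v \<inter> A"
      proof (rule component_subset_closed)
        show "v \<in> A" by (subst A[symmetric]) simp
        fix a b assume ab: "a \<in> A" "{a, b} \<in> ?S"
        then have e: "{a, b} \<in> ?S'" by (auto simp: touching_def open_edges_def)
        have "a \<in> component ?S' v" using ab(1) A by simp
        then have "b \<in> component ?S' v" by (rule component_trans[OF _ component_edge[OF e]])
        then show "b \<in> A \<and> {a, b} \<in> ?S'" using e A by simp
      qed
      then show "component ?S v = A" using sub A by blast
    next
      assume A: "component ?S v = A"
      have "component ?S v \<subseteq> component ?S' v \<inter> A"
      proof (rule component_subset_closed)
        show "v \<in> A" by (subst A[symmetric]) simp
        fix a b assume ab: "a \<in> A" "{a, b} \<in> ?S"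
        then have e: "{a, b} \<in> ?S'" by (auto simp: touching_def open_edges_def)
        have "a \<in> component ?S v" using ab(1) A by simp
        then have "b \<in> component ?S v" by (rule component_trans[OF _ component_edge[OF ab(2)]])
        then show "b \<in> A \<and> {a, b} \<in> ?S'" using e A by simp
      qed
      then show "component ?S' v = A" using sub A by blast
    qed
  qed
  have "component (open_edges E \<omega>) v \<subseteq> V" for \<omega>
    using assms by (intro component_subset_V) (auto simp: open_edges_def)
  then show ?thesis unfolding loc by auto
qed

lemma finite_component_event_sets:
  assumes p: "0 \<le> p" "p \<le> 1" and v: "v \<in> V"
  shows "{\<omega> \<in> space (percolation E p). finite (component (open_edges E \<omega>) v)} \<in> sets (percolation E p)"
  unfolding finite_component_event[OF v]
proof (rule sets.countable_UN''[OF countable_Collect_finite_subset[OF countable_V]])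
  fix A assume "A \<in> {A. finite A \<and> A \<subseteq> V}"
  then have X: "touching E A \<subseteq> E" "finite (touching E A)"
    using finite_touching[of A] by (auto simp: touching_def)
  show "{\<omega> \<in> space (percolation E p). component {e \<in> touching E A. \<omega> e} v = A} \<in> sets (percolation E p)"
    by (rule percolation_cylinder(1)[OF p X, of "\<lambda>S. component S v = A"])
qed

lemma theta_eq_complement:
  assumes p: "0 \<le> p" "p \<le> 1" and v: "v \<in> V"
  shows "theta E v p =
    1 - measure (percolation E p) {\<omega> \<in> space (percolation E p). finite (component (open_edges E \<omega>) v)}"
proof -
  interpret M: prob_space "percolation E p" by (rule prob_space_percolation)
  have "{\<omega> \<in> space (percolation E p). infinite (component (open_edges E \<omega>) v)} =
    space (percolation E p) - {\<omega> \<in> space (percolation E p). finite (component (open_edges E \<omega>) v)}"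
    by blast
  then show ?thesis
    unfolding theta_def using M.prob_compl[OF finite_component_event_sets[OF assms]] by simp
qed

text \<open>At density \<open>1\<close> each of the countably many events that the cluster is a given finite set is null.
  It follows that the infimum defining the critical parameter is over a nonempty set.\<close>

lemma theta_1:
  assumes v: "v \<in> V" shows "theta E v 1 = 1"
proof -
  interpret M: prob_space "percolation E 1" by (rule prob_space_percolation)
  have "{\<omega> \<in> space (percolation E 1). finite (component (open_edges E \<omega>) v)} \<in> null_sets (percolation E 1)"
    unfolding finite_component_event[OF v]
  proof (rule null_sets_UN'[OF countable_Collect_finite_subset[OF countable_V]])
    fix A assume "A \<in> {A. finite A \<and> A \<subseteq> V}"
    then have A: "finite A" "A \<subseteq> V" by auto
    have X: "touching E A \<subseteq> E" "finite (touching E A)"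
      using finite_touching[OF A] by (auto simp: touching_def)
    have "V \<subseteq> component E v" using connected[OF v] by blast
    then have "infinite (component E v)" using infinite_vertices finite_subset by blast
    then have "component (touching E A) v \<inter> (V - A) \<noteq> {}"
      using v A by (intro infinite_component_leaves) auto
    then have "component (touching E A) v \<noteq> A" by blast
    then have "measure (percolation E 1)
        {\<omega> \<in> space (percolation E 1). component {e \<in> touching E A. \<omega> e} v = A} = 0"
      using percolation_cylinder(2)[OF _ _ X, of 1 "\<lambda>S. component S v = A"] X(2)
      by (simp add: cube_prob_1)
    then show "{\<omega> \<in> space (percolation E 1). component {e \<in> touching E A. \<omega> e} v = A}
        \<in> null_sets (percolation E 1)"
      using percolation_cylinder(1)[OF _ _ X, of 1 "\<lambda>S. component S v = A"]
      by (simp add: null_sets_def M.emeasure_eq_measure)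
  qed
  then show ?thesis
    using theta_eq_complement[of 1 v] v by (simp add: measure_eq_0_null_sets)
qed

lemma theta_star_positive_at_1: "theta_star V E 1 > 0"
proof -
  have "V \<noteq> {}" using infinite_vertices by auto
  moreover have "theta_star V E 1 = (INF v\<in>V. 1)"
    unfolding theta_star_def by (rule INF_cong) (auto simp: theta_1)
  ultimately show ?thesis by simp
qed

text \<open>The edge boundary of the finite cluster is a finite closed cutset; it contains a minimal one, which is
  nonempty because the graph is infinite and connected.\<close>

lemma closed_minimal_cutset:
  assumes S: "S \<subseteq> E" and v: "v \<in> V" and fin: "finite (component S v)"
  shows "\<exists>n. \<exists>F\<in>minimal_cutsets E (Suc n) v. S \<inter> F = {}"
proof -
  let ?A = "component S v"
  let ?F0 = "edge_boundary E ?A"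
  have AV: "?A \<subseteq> V" using S v by (rule component_subset_V)
  have fin0: "finite ?F0"
    using finite_touching[OF fin AV] by (rule finite_subset[rotated]) (auto simp: edge_boundary_def touching_def)
  have F0: "cutset E v ?F0"
    using finite_subset[OF component_removed_boundary[of v ?A] fin]
    by (auto simp: cutset_def edge_boundary_def)
  let ?cuts = "{F. F \<subseteq> ?F0 \<and> cutset E v F}"
  have "finite ?cuts" "?F0 \<in> ?cuts" using fin0 F0 by simp_all
  then obtain F where "F \<in> ?cuts" and min: "\<forall>F'\<in>?cuts. F' \<subseteq> F \<longrightarrow> F = F'"
    using finite_has_minimal2[of ?cuts ?F0] by blast
  then have F: "F \<subseteq> ?F0" "cutset E v F" by simp_all
  have mc: "minimal_cutset E v F"
    unfolding minimal_cutset_def using F min by auto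
  have "finite F" using F(1) fin0 finite_subset by blast
  moreover have "F \<noteq> {}"
  proof
    assume "F = {}"
    then have "finite (component E v)" using F(2) by (simp add: cutset_def)
    moreover have "V \<subseteq> component E v" using connected[OF v] by blast
    ultimately show False using infinite_vertices finite_subset by blast
  qed
  ultimately obtain n where "card F = Suc n" by (metis card_eq_0_iff not0_implies_Suc)
  then have "F \<in> minimal_cutsets E (Suc n) v"
    using mc \<open>finite F\<close> by (simp add: minimal_cutsets_def)
  moreover have "S \<inter> ?F0 = {}"
  proof (rule equals0I)
    fix e assume e: "e \<in> S \<inter> ?F0"
    then obtain a b where ab: "e = {a, b}" "a \<in> ?A" "b \<notin> ?A" by (auto elim: edge_boundary_edge)
    then have "{a, b} \<in> S" using e by simp
    then show False using ab(2,3) component_trans[OF ab(2) component_edge] by blast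
  qed
  ultimately show ?thesis using F(1) by blast
qed

text \<open>At \<open>p = 1 - 1 / (4 K)\<close> a minimal cutset with \<open>n\<close> edges is closed with probability \<open>(4 K)\<^sup>-\<^sup>n\<close>, so the union
  bound over all of them is at most the sum of \<open>4\<^sup>-\<^sup>n\<close> for \<open>n \<ge> 1\<close>, which is \<open>1/3\<close>.\<close>

lemma peierls_bound:
  assumes K: "1 \<le> K"
    and Q: "\<And>n. finite (minimal_cutsets E (Suc n) v)"
      "\<And>n. real (card (minimal_cutsets E (Suc n) v)) \<le> K ^ Suc n"
    and v: "v \<in> V"
  shows "2 / 3 \<le> theta E v (1 - 1 / (4 * K))"
proof -
  define p where "p = 1 - 1 / (4 * K)"
  have p: "0 \<le> p" "p \<le> 1" using K by (auto simp: p_def field_simps)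
  let ?M = "percolation E p"
  interpret M: prob_space ?M by (rule prob_space_percolation)
  define closed where "closed = (\<lambda>F. {\<omega> \<in> space ?M. {e \<in> F. \<omega> e} = {}})"
  define U where "U = (\<lambda>n. \<Union>F\<in>minimal_cutsets E (Suc n) v. closed F)"
  have F: "F \<subseteq> E" "finite F" "card F = n" if "F \<in> minimal_cutsets E n v" for F n
    using that by (auto simp: minimal_cutsets_def minimal_cutset_def cutset_def)
  have closed: "closed F \<in> sets ?M" "measure ?M (closed F) = (1 - p) ^ n"
    if "F \<in> minimal_cutsets E n v" for F n
    using percolation_cylinder[OF p F(1,2)[OF that], of "\<lambda>S. S = {}"] F[OF that]
    by (simp_all add: closed_def cube_prob_all_closed)
  have U_sets: "U n \<in> sets ?M" for n
    unfolding U_def using Q(1) closed(1) by blast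
  have U_measure: "measure ?M (U n) \<le> (1 / 4) ^ Suc n" for n
  proof -
    have "measure ?M (U n) \<le> (\<Sum>F\<in>minimal_cutsets E (Suc n) v. measure ?M (closed F))"
      unfolding U_def using Q(1) closed(1) by (intro M.finite_measure_subadditive_finite) auto
    also have "\<dots> = real (card (minimal_cutsets E (Suc n) v)) * (1 - p) ^ Suc n"
      using closed(2) by simp
    also have "\<dots> \<le> K ^ Suc n * (1 - p) ^ Suc n"
      using Q(2)[of n] p by (intro mult_right_mono) auto
    also have "\<dots> = (K * (1 - p)) ^ Suc n" by (simp only: power_mult_distrib)
    also have "K * (1 - p) = 1 / 4" using K by (simp add: p_def)
    finally show ?thesis .
  qed
  have geo: "(\<lambda>n. (1 / 4 :: real) ^ Suc n) sums (1 / 3)"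
    using sums_mult[OF geometric_sums[of "1 / 4 :: real"], of "1 / 4"] by simp
  have summable: "summable (\<lambda>n. measure ?M (U n))"
    using U_measure by (intro summable_comparison_test'[OF sums_summable[OF geo], of 0]) simp
  have "{\<omega> \<in> space ?M. finite (component (open_edges E \<omega>) v)} \<subseteq> (\<Union>n. U n)"
  proof
    fix \<omega> assume \<omega>: "\<omega> \<in> {\<omega> \<in> space ?M. finite (component (open_edges E \<omega>) v)}"
    then obtain n F where nF: "F \<in> minimal_cutsets E (Suc n) v" "open_edges E \<omega> \<inter> F = {}"
      using closed_minimal_cutset[of "open_edges E \<omega>" v] v by (auto simp: open_edges_def)
    then have "{e \<in> F. \<omega> e} = {}" using F(1) by (auto simp: open_edges_def)
    then show "\<omega> \<in> (\<Union>n. U n)" using nF(1) \<omega> by (auto simp: U_def closed_def)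
  qed
  then have "measure ?M {\<omega> \<in> space ?M. finite (component (open_edges E \<omega>) v)} \<le> measure ?M (\<Union>n. U n)"
    using U_sets by (intro M.finite_measure_mono) auto
  also have "\<dots> \<le> (\<Sum>n. measure ?M (U n))"
    using U_sets summable by (intro M.finite_measure_subadditive_countably) auto
  also have "\<dots> \<le> (\<Sum>n. (1 / 4) ^ Suc n)"
    using U_measure summable sums_summable[OF geo] by (intro suminf_le) auto
  also have "\<dots> = 1 / 3" by (rule sums_unique[OF geo, symmetric])
  finally show ?thesis
    using theta_eq_complement[OF p v] by (simp add: p_def)
qed

lemma minimal_cutsets_bound_of_kappa:
  assumes "kappa V E < \<infinity>" and n: "n \<ge> 1" and v: "v \<in> V"
  shows "finite (minimal_cutsets E n v)"
    and "real (card (minimal_cutsets E n v)) \<le> enn2real (kappa V E) ^ n"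
proof -
  let ?Q = "minimal_cutsets E n v"
  have le: "ennreal_root n (q_sup V E n) \<le> kappa V E"
    unfolding kappa_def using n by (intro SUP_upper) auto
  then have q: "q_sup V E n \<noteq> \<infinity>"
    using assms(1) by (auto simp: ennreal_root_def)
  have le_q: "emeasure (count_space UNIV) ?Q \<le> q_sup V E n"
    unfolding q_sup_def using v by (rule SUP_upper)
  show fin: "finite ?Q"
  proof (rule ccontr)
    assume "infinite ?Q"
    then show False using le_q q by (simp add: emeasure_count_space_infinite top_unique)
  qed
  have "ennreal (root n (enn2real (q_sup V E n))) \<le> kappa V E"
    using le q by (simp add: ennreal_root_def)
  then have "root n (enn2real (q_sup V E n)) \<le> enn2real (kappa V E)"
    using assms(1) by (cases "kappa V E") (auto simp: ennreal_le_iff2)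
  then have "root n (enn2real (q_sup V E n)) ^ n \<le> enn2real (kappa V E) ^ n"
    using n by (intro power_mono) (auto intro: real_root_ge_zero)
  then have "enn2real (q_sup V E n) \<le> enn2real (kappa V E) ^ n" using n by simp
  moreover have "real (card ?Q) \<le> enn2real (q_sup V E n)"
    using le_q fin q by (cases "q_sup V E n") (auto simp: ennreal_of_nat_eq_real_of_nat)
  ultimately show "real (card ?Q) \<le> enn2real (kappa V E) ^ n" by simp
qed

lemma kappa_finite_of_bound:
  assumes C: "0 \<le> C"
    and Q: "\<And>n v Q. \<lbrakk>v \<in> V; finite Q; Q \<subseteq> minimal_cutsets E n v\<rbrakk> \<Longrightarrow> real (card Q) \<le> C ^ n"
  shows "kappa V E < \<infinity>"
proof -
  have q: "q_sup V E n \<le> ennreal (C ^ n)" for n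
    unfolding q_sup_def
  proof (rule SUP_least)
    fix v assume v: "v \<in> V"
    let ?Q = "minimal_cutsets E n v"
    have fin: "finite ?Q"
    proof (rule ccontr)
      assume "infinite ?Q"
      moreover obtain m where m: "C ^ n < real m" using reals_Archimedean2 by blast
      ultimately obtain Q' where "finite Q'" "card Q' = m" "Q' \<subseteq> ?Q"
        using infinite_arbitrarily_large by blast
      then show False using Q[OF v, of Q' n] m by auto
    qed
    then show "emeasure (count_space UNIV) ?Q \<le> ennreal (C ^ n)"
      using Q[OF v fin order_refl] by (simp add: ennreal_of_nat_eq_real_of_nat ennreal_leI)
  qed
  have "ennreal_root n (q_sup V E n) \<le> ennreal C" if n: "n \<ge> 1" for n
  proof -
    have fin: "q_sup V E n < \<infinity>" using q[of n] by (rule order.strict_trans1) simp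
    have "enn2real (q_sup V E n) \<le> C ^ n" using q[of n] C by (intro enn2real_leI) auto
    then have "root n (enn2real (q_sup V E n)) \<le> root n (C ^ n)" using n by simp
    also have "\<dots> = C" using n C by (simp add: real_root_power_cancel)
    finally show ?thesis using less_imp_neq[OF fin] by (simp add: ennreal_root_def ennreal_leI)
  qed
  then have "kappa V E \<le> ennreal C" unfolding kappa_def by (intro SUP_least) auto
  then show ?thesis by (rule order.strict_trans1) simp
qed

theorem pc_star_less_1_iff: "pc_star V E < 1 \<longleftrightarrow> kappa V E < \<infinity>"
proof
  assume "pc_star V E < 1"
  moreover have "{p \<in> {0..1}. theta_star V E p > 0} \<noteq> {}"
    using theta_star_positive_at_1 by (auto intro: exI[of _ 1])
  ultimately obtain p where p: "0 \<le> p" "p < 1" "theta_star V E p > 0"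
    using cInf_lessD unfolding pc_star_def by (metis (mono_tags, lifting) atLeastAtMost_iff mem_Collect_eq)
  define \<theta> where "\<theta> = theta_star V E p"
  have \<theta>_le: "\<theta> \<le> theta E v p" if "v \<in> V" for v
    unfolding \<theta>_def theta_star_def using that theta_bounds by (intro cINF_lower bdd_belowI2[of _ 0]) auto
  obtain v0 where "v0 \<in> V" using infinite_vertices by fastforce
  then have \<theta>: "0 < \<theta>" "\<theta> \<le> 1" using p(3) \<theta>_le[of v0] theta_bounds(2)[of E v0 p] by (auto simp: \<theta>_def)
  \<comment> \<open>The counting bound needs a positive density, so \<open>p\<close> is raised first.\<close>
  define p1 where "p1 = (1 + p) / 2"
  have p1: "0 < p1" "p1 < 1" "p \<le> p1" using p by (auto simp: p1_def)
  have escape: "\<theta> \<le> cube_prob (touching E B) p1 (\<lambda>S. joins S {u} (V - B))"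
    if "u \<in> V" "finite B" "B \<subseteq> V" for u B
  proof -
    have "\<theta> \<le> cube_prob (touching E B) p (\<lambda>S. joins S {u} (V - B))"
      using \<theta>_le[OF that(1)] theta_le_cube_prob[of p u B] p that by linarith
    also have "\<dots> \<le> cube_prob (touching E B) p1 (\<lambda>S. joins S {u} (V - B))"
      using p p1 that by (intro cube_prob_mono_param finite_touching joins_increasing) auto
    finally show ?thesis .
  qed
  define \<gamma> where "\<gamma> = (p1 * (\<theta> / 2)\<^sup>2)\<^sup>2 / 4 ^ 6 * ((1 - p1) / 2)"
  have \<gamma>: "0 < \<gamma>" using p1 \<theta> by (simp add: \<gamma>_def)
  show "kappa V E < \<infinity>"
  proof (rule kappa_finite_of_bound)
    show "0 \<le> 1 / \<gamma>" using \<gamma> by simp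
    fix n v Q assume "v \<in> V" "finite Q" "Q \<subseteq> minimal_cutsets E n v"
    then have "real (card Q) * \<gamma> ^ n \<le> 1"
      unfolding \<gamma>_def by (intro card_minimal_cutsets_le p1(1,2) \<theta> escape)
    then show "real (card Q) \<le> (1 / \<gamma>) ^ n" using \<gamma> by (simp add: power_one_over field_simps)
  qed
next
  assume kappa: "kappa V E < \<infinity>"
  define K where "K = max 1 (enn2real (kappa V E))"
  define p where "p = 1 - 1 / (4 * K)"
  have K: "1 \<le> K" by (simp add: K_def)
  have p: "0 \<le> p" "p < 1" using K by (auto simp: p_def field_simps)
  have "2 / 3 \<le> theta E v p" if v: "v \<in> V" for v
    unfolding p_def
  proof (rule peierls_bound[OF K _ _ v])
    fix n
    show "finite (minimal_cutsets E (Suc n) v)"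
      using minimal_cutsets_bound_of_kappa(1)[OF kappa _ v] by simp
    have "real (card (minimal_cutsets E (Suc n) v)) \<le> enn2real (kappa V E) ^ Suc n"
      using minimal_cutsets_bound_of_kappa(2)[OF kappa _ v, of "Suc n"] by simp
    also have "\<dots> \<le> K ^ Suc n" by (rule power_mono) (auto simp: K_def)
    finally show "real (card (minimal_cutsets E (Suc n) v)) \<le> K ^ Suc n" .
  qed
  then have "2 / 3 \<le> theta_star V E p"
    unfolding theta_star_def using infinite_vertices by (intro cINF_greatest) auto
  then have "p \<in> {p \<in> {0..1}. theta_star V E p > 0}" using p by simp
  then have "pc_star V E \<le> p" unfolding pc_star_def by (intro cInf_lower bdd_belowI[of _ 0]) auto
  then show "pc_star V E < 1" using p by simp
qed

end

theorem theorem1: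
  fixes V :: "'a set" and E :: "'a set set"
  assumes "infinite_connected_locally_finite_graph V E"
  shows "pc_star V E < 1 \<longleftrightarrow> kappa V E < \<infinity>"
  by (rule infinite_connected_locally_finite_graph.pc_star_less_1_iff[OF assms])

end
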